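(* For any integers $r,s,t$ with $r\geq s+2\geq 3$ and $t\geq 1$, we have $\mathrm{ex}(n,F_{r,s}^t)=O\left(n^{2-\frac{r+1}{rs+r}}\right)$ as $n\to\infty$, where the implied constant may depend on $r,s,t$.
   Context: All graphs are finite and simple. For a positive integer $n$ and a graph $H$, $\mathrm{ex}(n,H)$ is the largest number of edges in an $n$-vertex graph that does not contain $H$ as a (not necessarily induced) subgraph. For integers $r,s\geq 1$, $F_{r,s}$ is the rooted graph (tree) with vertices $y$, $z_i$ ($1\leq i\leq r$) and $w_{i,j}$ ($1\leq i\leq r$, $1\leq j\leq s$), with edges $yz_i$ for all $1\leq i\leq r$ and $z_iw_{i,j}$ for all $1\leq i\leq r$, $1\leq j\leq s$, and with the set of roots being $\{w_{i,j}: 1\leq i\leq r, 1\leq j\leq s\}$. For a rooted graph $F$ with root set $R$ and a positive integer $t$, the $t$-blowup $F^t$ is the graph obtained by taking $t$ vertex-disjoint copies of $F$ and, for each $v\in R$, identifying the $t$ copies of $v$ into one vertex. Thus $F_{r,s}^t$ has $rs+t(r+1)$ vertices. *)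

theory Defs
  imports Complex_Main "HOL-Library.Landau_Symbols"
begin

text \<open>Edges are two-element sets of vertices.\<close>

record 'a graph =
  verts :: "'a set"
  edges :: "'a set set"

record 'a rooted_graph = "'a graph" +
  roots :: "'a set"

definition simple_graph :: "('a, 'm) graph_scheme \<Rightarrow> bool" where
  "simple_graph G \<longleftrightarrow> finite (verts G) \<and> (\<forall>e\<in>edges G. e \<subseteq> verts G \<and> card e = 2)"

definition contains_subgraph :: "('a, 'm) graph_scheme \<Rightarrow> ('b, 'k) graph_scheme \<Rightarrow> bool" where
  "contains_subgraph G H \<longleftrightarrow>
     (\<exists>f. inj_on f (verts H) \<and> f ` verts H \<subseteq> verts G \<and> (\<forall>e\<in>edges H. f ` e \<in> edges G))"

text \<open>
  Every finite graph is isomorphic to one whose vertices are natural numbers, so it suffices to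
  range over those. The set of edge numbers is finite, and it is nonempty whenever \<open>H\<close> has an edge;
  in the degenerate case of an edgeless \<open>H\<close> with at most \<open>n\<close> vertices it is empty and the value
  is unspecified.
\<close>

definition ex_num :: "nat \<Rightarrow> ('a, 'm) graph_scheme \<Rightarrow> nat" where
  "ex_num n H = Max {card (edges G) | G :: nat graph.
     simple_graph G \<and> card (verts G) = n \<and> \<not> contains_subgraph G H}"

datatype F_vertex = Fy | Fz nat | Fw nat nat

definition F_graph :: "nat \<Rightarrow> nat \<Rightarrow> F_vertex rooted_graph" where
  "F_graph r s = \<lparr>
     verts = {Fy} \<union> {Fz i | i. i \<in> {1..r}} \<union> {Fw i j | i j. i \<in> {1..r} \<and> j \<in> {1..s}},
     edges = {{Fy, Fz i} | i. i \<in> {1..r}} \<union> {{Fz i, Fw i j} | i j. i \<in> {1..r} \<and> j \<in> {1..s}},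
     roots = {Fw i j | i j. i \<in> {1..r} \<and> j \<in> {1..s}} \<rparr>"

text \<open>
  The vertex \<open>v\<close> of the \<open>k\<close>-th copy becomes \<open>Inr (k, v)\<close>, except that the copies of a root \<open>v\<close>
  are all identified to the single vertex \<open>Inl v\<close>.
\<close>

definition copy_vertex :: "'a set \<Rightarrow> nat \<Rightarrow> 'a \<Rightarrow> 'a + nat \<times> 'a" where
  "copy_vertex R k v = (if v \<in> R then Inl v else Inr (k, v))"

definition blowup :: "'a rooted_graph \<Rightarrow> nat \<Rightarrow> ('a + nat \<times> 'a) graph" where
  "blowup F t = \<lparr>
     verts = (\<Union>k\<in>{1..t}. copy_vertex (roots F) k ` verts F),
     edges = (\<Union>k\<in>{1..t}. (\<lambda>e. copy_vertex (roots F) k ` e) ` edges F) \<rparr>"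

end

theory Submission
  imports Defs
begin

text \<open>
  Let \<open>G\<close> be a graph without the blowup, with \<open>n\<close> vertices and so many edges that its average degree
  is a large multiple of \<open>n powr (\<alpha> - 1)\<close>, where \<open>\<alpha> = 2 - (r + 1) / (r * (s + 1))\<close>. Since \<open>\<alpha> > 1\<close>,
  a subgraph maximising the ratio of degree sum and \<open>n powr \<alpha>\<close> contains a part in which the maximum
  degree \<open>\<Delta>\<close> has the order of the average (\<open>exists_dense_part_of_bounded_degree\<close>). There
  \<open>\<Delta> ^ (r * (s + 1)) \<ge> C * n ^ (r * s - 1)\<close> with a large constant \<open>C\<close>, where from now on \<open>n\<close> bounds
  the number of vertices of this part.

  Call a set of \<open>s + 1\<close> vertices light if it has boundedly many common neighbours. A set of
  \<open>t + r * s\<close> vertices all of whose \<open>(s + 1)\<close>-subsets are heavy would yield the blowup greedily,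
  hence a positive proportion of the \<open>(s + 1)\<close>-subsets of any large vertex set is light
  (\<open>power_card_le_light_subsets\<close>). By convexity there are many copies of
  \<open>F_graph r s\<close> in which the centre \<open>y\<close> forms a light set with the roots of each branch, and so an
  average tuple \<open>Ws\<close> of \<open>r\<close> root sets has at least a large constant number of such centres
  (\<open>sum_card_centres_ge\<close>). As the blowup is absent, a positive proportion of the centres of \<open>Ws\<close> has
  the same middle vertex on some branch (\<open>centres_crowd_around_vertex\<close>). Among these centres the light
  \<open>(s + 1)\<close>-sets are dense again. Hence, in a positive proportion of all pairs of a tuple \<open>Ws\<close> and an
  \<open>(s + 1)\<close>-set \<open>Y\<close> of its centres, \<open>Y\<close> is light and has a common neighbour with one of the root sets.

  Now count these pairs from the side of \<open>Y\<close>. If \<open>q\<close> root sets are joined to all of \<open>Y\<close>, there are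
  about \<open>q ^ r\<close> tuples for \<open>Y\<close>, while at most a constant times \<open>\<Delta> ^ s * q ^ (r - 1)\<close> of them share a
  neighbour with \<open>Y\<close>, because \<open>Y\<close> is light (\<open>shared_root_tuples_few_or_rare\<close>). So \<open>q\<close> is of order at
  most \<open>\<Delta> ^ s\<close> for the sets \<open>Y\<close> that matter, and these sets lie in a neighbourhood, so there are at
  most \<open>n * \<Delta> ^ (s + 1)\<close> of them. Altogether the pairs number at most a constant times
  \<open>n * \<Delta> ^ (s * r + s + 1) \<le> n * \<Delta> ^ (r * (s + 1))\<close>, as \<open>r > s\<close>. By the previous paragraph there are
  more, by a factor growing with \<open>C\<close> (\<open>degree_sum_lt\<close>).
\<close>

section \<open>Counting in finite sets\<close>

lemma sum_card_swap:
  assumes "finite A" "finite B"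
  shows "(\<Sum>a\<in>A. card {b \<in> B. R a b}) = (\<Sum>b\<in>B. card {a \<in> A. R a b})"
proof -
  have "card {b \<in> B. R a b} = (\<Sum>b\<in>B. if R a b then 1 else 0)" for a
    using assms by (simp add: sum.If_cases Int_def)
  moreover have "card {a \<in> A. R a b} = (\<Sum>a\<in>A. if R a b then 1 else 0)" for b
    using assms by (simp add: sum.If_cases Int_def)
  ultimately show ?thesis by (simp add: sum.swap[of _ A B])
qed

text \<open>The step of the induction is Chebyshev's sum inequality for the similarly ordered
  sequences \<open>f\<close> and \<open>f ^ Suc m\<close>.\<close>

lemma power_mean_sum:
  fixes f :: "'a \<Rightarrow> real"
  assumes "finite S" and nonneg: "\<And>x. x \<in> S \<Longrightarrow> 0 \<le> f x"
  shows "(\<Sum>x\<in>S. f x) ^ Suc m \<le> real (card S) ^ m * (\<Sum>x\<in>S. f x ^ Suc m)"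
proof (induction m)
  case 0
  show ?case by simp
next
  case (Suc m)
  let ?p = "\<lambda>k. \<Sum>x\<in>S. f x ^ k"
  have "0 \<le> (\<Sum>x\<in>S. \<Sum>y\<in>S. (f x - f y) * (f x ^ Suc m - f y ^ Suc m))"
  proof (intro sum_nonneg)
    fix x y assume "x \<in> S" "y \<in> S"
    then have "0 \<le> f x" "0 \<le> f y" using nonneg by auto
    then show "0 \<le> (f x - f y) * (f x ^ Suc m - f y ^ Suc m)"
      by (cases "f x \<le> f y")
         (auto intro!: mult_nonneg_nonneg mult_nonpos_nonpos power_mono
               simp del: power_Suc simp: power_mono)
  qed
  also have "\<dots> = (\<Sum>x\<in>S. \<Sum>y\<in>S. f x ^ Suc (Suc m) - f x ^ Suc m * f y
                      - f x * f y ^ Suc m + f y ^ Suc (Suc m))"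
    by (simp add: algebra_simps)
  also have "\<dots> = 2 * (real (card S) * ?p (Suc (Suc m)) - (\<Sum>x\<in>S. f x) * ?p (Suc m))"
    by (simp add: sum.distrib sum_subtractf flip: sum_distrib_left sum_distrib_right
             del: power_Suc)
  finally have cheb: "(\<Sum>x\<in>S. f x) * ?p (Suc m) \<le> real (card S) * ?p (Suc (Suc m))"
    by simp
  have "(\<Sum>x\<in>S. f x) ^ Suc (Suc m) \<le> (\<Sum>x\<in>S. f x) * (real (card S) ^ m * ?p (Suc m))"
    using Suc.IH nonneg by (simp add: sum_nonneg mult_left_mono)
  also have "\<dots> = real (card S) ^ m * ((\<Sum>x\<in>S. f x) * ?p (Suc m))" by (simp del: power_Suc)
  also have "\<dots> \<le> real (card S) ^ m * (real (card S) * ?p (Suc (Suc m)))"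
    using cheb by (intro mult_left_mono) auto
  finally show ?case by (simp add: mult.assoc mult.left_commute)
qed

lemma card_sets_of_size_le_power:
  assumes "finite P"
  shows "card {W. W \<subseteq> P \<and> card W = k} \<le> card P ^ k"
proof (cases "k \<le> card P")
  case True
  then show ?thesis using assms by (simp add: n_subsets binomial_le_pow)
next
  case False
  then show ?thesis using assms by (simp add: n_subsets binomial_eq_0)
qed

lemma card_sets_of_size_through_le_power:
  assumes "finite P"
  shows "card {W. W \<subseteq> P \<and> card W = Suc k \<and> w \<in> W} \<le> card P ^ k"
proof -
  have "{W. W \<subseteq> P \<and> card W = Suc k \<and> w \<in> W} \<subseteq> insert w ` {W. W \<subseteq> P \<and> card W = k}"
  proof
    fix W assume W: "W \<in> {W. W \<subseteq> P \<and> card W = Suc k \<and> w \<in> W}"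
    then have "W = insert w (W - {w})" "W - {w} \<subseteq> P" "card (W - {w}) = k" by auto
    then show "W \<in> insert w ` {W. W \<subseteq> P \<and> card W = k}" by blast
  qed
  then have "card {W. W \<subseteq> P \<and> card W = Suc k \<and> w \<in> W} \<le> card {W. W \<subseteq> P \<and> card W = k}"
    using assms by (intro surj_card_le) auto
  then show ?thesis using card_sets_of_size_le_power[OF assms, of k] by linarith
qed

lemma card_supersets_of_size:
  assumes "finite P" "S \<subseteq> P" "card S \<le> m"
  shows "card {Q. Q \<subseteq> P \<and> card Q = m \<and> S \<subseteq> Q} = (card P - card S) choose (m - card S)"
proof -
  have fS: "finite S" using assms finite_subset by blast
  have "bij_betw (\<lambda>X. X \<union> S) {X. X \<subseteq> P - S \<and> card X = m - card S}
          {Q. Q \<subseteq> P \<and> card Q = m \<and> S \<subseteq> Q}"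
  proof (rule bij_betw_byWitness[where f' = "\<lambda>Q. Q - S"])
    show "(\<lambda>X. X \<union> S) ` {X. X \<subseteq> P - S \<and> card X = m - card S}
            \<subseteq> {Q. Q \<subseteq> P \<and> card Q = m \<and> S \<subseteq> Q}"
    proof clarify
      fix X assume X: "X \<subseteq> P - S" "card X = m - card S"
      then have "finite X" using assms(1) finite_subset by blast
      then have "card (X \<union> S) = m" using X fS assms(3) by (subst card_Un_disjoint) auto
      then show "X \<union> S \<subseteq> P \<and> card (X \<union> S) = m \<and> S \<subseteq> X \<union> S" using X assms(2) by auto
    qed
    show "(\<lambda>Q. Q - S) ` {Q. Q \<subseteq> P \<and> card Q = m \<and> S \<subseteq> Q}
            \<subseteq> {X. X \<subseteq> P - S \<and> card X = m - card S}"
      using fS by (auto simp: card_Diff_subset)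
  qed auto
  from bij_betw_same_card[OF this] have "card {Q. Q \<subseteq> P \<and> card Q = m \<and> S \<subseteq> Q}
      = card {X. X \<subseteq> P - S \<and> card X = m - card S}" by simp
  also have "\<dots> = card (P - S) choose (m - card S)" using assms(1) by (simp add: n_subsets)
  finally show ?thesis using assms fS by (simp add: card_Diff_subset)
qed

text \<open>A family that meets every \<open>m\<close>-set has positive density among the \<open>k\<close>-sets: count the pairs
  of an \<open>m\<close>-set and a member of the family inside it.\<close>

lemma choose_le_card_hitting_family:
  assumes "finite P" "k \<le> m" "m \<le> card P"
    and hit: "\<And>Q. Q \<subseteq> P \<Longrightarrow> card Q = m \<Longrightarrow> \<exists>S\<subseteq>Q. card S = k \<and> L S"
  shows "card P choose k \<le> card {S. S \<subseteq> P \<and> card S = k \<and> L S} * (m choose k)"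
proof -
  let ?F = "{S. S \<subseteq> P \<and> card S = k \<and> L S}"
  let ?c = "(card P - k) choose (m - k)"
  have fF: "finite ?F" using assms(1) by auto
  have "card P choose m = card {Q. Q \<subseteq> P \<and> card Q = m}" using assms(1) by (simp add: n_subsets)
  also have "\<dots> \<le> card (\<Union>S\<in>?F. {Q. Q \<subseteq> P \<and> card Q = m \<and> S \<subseteq> Q})"
  proof (rule card_mono)
    show "finite (\<Union>S\<in>?F. {Q. Q \<subseteq> P \<and> card Q = m \<and> S \<subseteq> Q})" using assms(1) by auto
    show "{Q. Q \<subseteq> P \<and> card Q = m} \<subseteq> (\<Union>S\<in>?F. {Q. Q \<subseteq> P \<and> card Q = m \<and> S \<subseteq> Q})"
    proof
      fix Q assume Q: "Q \<in> {Q. Q \<subseteq> P \<and> card Q = m}"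
      then obtain S where "S \<subseteq> Q" "card S = k" "L S" using hit[of Q] by auto
      with Q show "Q \<in> (\<Union>S\<in>?F. {Q. Q \<subseteq> P \<and> card Q = m \<and> S \<subseteq> Q})" by auto
    qed
  qed
  also have "\<dots> \<le> (\<Sum>S\<in>?F. card {Q. Q \<subseteq> P \<and> card Q = m \<and> S \<subseteq> Q})"
    by (rule card_UN_le[OF fF])
  also have "\<dots> = (\<Sum>S\<in>?F. ?c)"
  proof (rule sum.cong[OF refl])
    fix S assume "S \<in> ?F"
    then show "card {Q. Q \<subseteq> P \<and> card Q = m \<and> S \<subseteq> Q} = ?c"
      using card_supersets_of_size[of P S m] assms by auto
  qed
  finally have "card P choose m \<le> card ?F * ?c" by simp
  then have "(card P choose m) * (m choose k) \<le> card ?F * ?c * (m choose k)"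
    by (rule mult_right_mono) simp
  moreover have "(card P choose m) * (m choose k) = (card P choose k) * ?c"
    using assms by (intro choose_mult) auto
  moreover have "0 < ?c" using assms by simp
  ultimately have "(card P choose k) * ?c \<le> (card ?F * (m choose k)) * ?c"
    by (simp only: mult.assoc mult.commute mult.left_commute)
  then show ?thesis using \<open>0 < ?c\<close> by (rule mult_right_le_imp_le)
qed

lemma distinct_representatives_avoiding:
  assumes "finite I" "finite U" "\<And>i. i \<in> I \<Longrightarrow> card I + card U \<le> card (C i)"
  shows "\<exists>f. inj_on f I \<and> (\<forall>i\<in>I. f i \<in> C i - U)"
  using assms(1,3)
proof (induction I)
  case empty
  then show ?case by simp
next
  case (insert x I)
  have "card I + card U \<le> card (C i)" if "i \<in> I" for i
    using insert.prems[of i] that insert.hyps by simp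
  then obtain f where f: "inj_on f I" "\<forall>i\<in>I. f i \<in> C i - U"
    using insert.IH by blast
  have "card (U \<union> f ` I) \<le> card U + card I"
    using card_Un_le[of U "f ` I"] card_image_le[OF insert.hyps(1), of f] by linarith
  also have "\<dots> < card (C x)" using insert.prems[of x] insert.hyps by simp
  finally have "\<not> C x \<subseteq> U \<union> f ` I"
    using card_mono[of "U \<union> f ` I" "C x"] assms(2) insert.hyps(1) by auto
  then obtain c where c: "c \<in> C x" "c \<notin> U" "c \<notin> f ` I" by blast
  have "inj_on (f(x := c)) (insert x I)"
    using f(1) c(3) insert.hyps(2) by (auto simp: inj_on_def)
  moreover have "\<forall>i\<in>insert x I. (f(x := c)) i \<in> C i - U"
    using f(2) c insert.hyps(2) by auto
  ultimately show ?case by blast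
qed

text \<open>Build the list from its end; each element already present forbids at most \<open>\<kappa>\<close> choices.\<close>

lemma card_clash_free_lists:
  assumes "finite A" and few: "\<And>b. b \<in> A \<Longrightarrow> card {a \<in> A. clash a b} \<le> \<kappa>"
  shows "(card A - m * \<kappa>) ^ m
           \<le> card {xs. length xs = m \<and> set xs \<subseteq> A \<and> sorted_wrt (\<lambda>a b. \<not> clash a b) xs}"
proof (induction m)
  case 0
  have "{xs. length xs = 0 \<and> set xs \<subseteq> A \<and> sorted_wrt (\<lambda>a b. \<not> clash a b) xs} = {[]}" by auto
  then show ?case by simp
next
  case (Suc m)
  define L where
    "L m = {xs. length xs = m \<and> set xs \<subseteq> A \<and> sorted_wrt (\<lambda>a b. \<not> clash a b) xs}" for m
  have finL: "finite (L m)" for m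
    using finite_lists_length_eq[OF assms(1), of m] by (rule rev_finite_subset) (auto simp: L_def)
  define E where "E xs = {a \<in> A. \<forall>b\<in>set xs. \<not> clash a b}" for xs
  have E: "card A - m * \<kappa> \<le> card (E xs)" if "xs \<in> L m" for xs
  proof -
    have "A - E xs = (\<Union>b\<in>set xs. {a \<in> A. clash a b})" by (auto simp: E_def)
    then have "card (A - E xs) \<le> (\<Sum>b\<in>set xs. card {a \<in> A. clash a b})"
      by (simp add: card_UN_le)
    also have "\<dots> \<le> card (set xs) * \<kappa>"
      using that few by (intro sum_bounded_above[THEN order_trans]) (auto simp: L_def)
    also have "\<dots> \<le> m * \<kappa>" using that card_length[of xs] by (auto simp: L_def)
    finally have "card (A - E xs) \<le> m * \<kappa>" .
    moreover have "card (A - E xs) = card A - card (E xs)"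
      using assms(1) by (intro card_Diff_subset) (auto simp: E_def)
    ultimately show ?thesis by linarith
  qed
  have inj: "inj_on (\<lambda>(xs, a). a # xs) (SIGMA xs:L m. E xs)" by (auto simp: inj_on_def)
  have "(card A - Suc m * \<kappa>) ^ Suc m \<le> (card A - m * \<kappa>) ^ m * (card A - m * \<kappa>)"
    by (subst power_Suc2, intro mult_mono power_mono) auto
  also have "\<dots> \<le> card (L m) * (card A - m * \<kappa>)"
    using Suc.IH by (intro mult_right_mono) (auto simp: L_def)
  also have "\<dots> \<le> (\<Sum>xs\<in>L m. card (E xs))"
    using sum_bounded_below[of "L m" "card A - m * \<kappa>" "\<lambda>xs. card (E xs)"] E by simp
  also have "\<dots> = card (SIGMA xs:L m. E xs)" using finL assms(1) by (simp add: E_def)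
  also have "\<dots> = card ((\<lambda>(xs, a). a # xs) ` (SIGMA xs:L m. E xs))"
    by (rule card_image[OF inj, symmetric])
  also have "\<dots> \<le> card (L (Suc m))"
    by (rule card_mono[OF finL]) (auto simp: L_def E_def)
  finally show ?case by (simp add: L_def)
qed

lemma card_lists_with_entry:
  assumes "finite A" "G \<subseteq> A" "i < m"
  shows "card {xs. length xs = m \<and> set xs \<subseteq> A \<and> xs ! i \<in> G} \<le> card G * card A ^ (m - 1)"
proof -
  let ?L = "{xs. set xs \<subseteq> A \<and> length xs = m - 1}"
  let ?f = "\<lambda>xs. (xs ! i, take i xs @ drop (Suc i) xs)"
  have "inj_on ?f {xs. length xs = m \<and> set xs \<subseteq> A \<and> xs ! i \<in> G}"
  proof (rule inj_onI)
    fix xs ys assume "xs \<in> {xs. length xs = m \<and> set xs \<subseteq> A \<and> xs ! i \<in> G}"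
      and "ys \<in> {xs. length xs = m \<and> set xs \<subseteq> A \<and> xs ! i \<in> G}" and eq: "?f xs = ?f ys"
    then have len: "i < length xs" "i < length ys" "length xs = length ys" using assms(3) by auto
    then have "take i xs = take i ys" "drop (Suc i) xs = drop (Suc i) ys"
      using eq by (auto simp: append_eq_append_conv)
    then show "xs = ys" using eq id_take_nth_drop[OF len(1)] id_take_nth_drop[OF len(2)] by simp
  qed
  moreover have "?f ` {xs. length xs = m \<and> set xs \<subseteq> A \<and> xs ! i \<in> G} \<subseteq> G \<times> ?L"
    using assms(3) by (auto dest!: in_set_takeD in_set_dropD)
  moreover have "finite (G \<times> ?L)"
    using finite_subset[OF assms(2,1)] finite_lists_length_eq[OF assms(1), of "m - 1"] by simp
  ultimately have "card {xs. length xs = m \<and> set xs \<subseteq> A \<and> xs ! i \<in> G} \<le> card (G \<times> ?L)"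
    by (meson card_inj_on_le)
  then show ?thesis using assms(1) by (simp add: card_cartesian_product card_lists_length_eq)
qed

section \<open>Light sets in a graph without blowups\<close>

text \<open>Copies of the rooted tree over the same root sets \<open>W i\<close>, indexed by their centres \<open>y\<close>; the
  \<open>i\<close>-th branch of the copy at \<open>y\<close> has the middle vertex \<open>z y i\<close>.\<close>

definition disjoint_copies ::
  "('a \<Rightarrow> 'a set) \<Rightarrow> nat \<Rightarrow> (nat \<Rightarrow> 'a set) \<Rightarrow> 'a set \<Rightarrow> ('a \<Rightarrow> nat \<Rightarrow> 'a) \<Rightarrow> bool" where
  "disjoint_copies N r W Y z \<longleftrightarrow>
     (\<forall>i<r. \<forall>j<r. i \<noteq> j \<longrightarrow> W i \<inter> W j = {}) \<and>
     Y \<inter> (\<Union>i<r. W i) = {} \<and>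
     (\<forall>y\<in>Y. \<forall>i<r. insert y (W i) \<subseteq> N (z y i) \<and> z y i \<notin> Y \<union> (\<Union>i<r. W i)) \<and>
     inj_on (\<lambda>(y, i). z y i) (Y \<times> {..<r})"

text \<open>The graph is given by its neighbourhoods, and blowups are excluded in the form in which they
  arise: as \<open>t\<close> disjoint copies over common root sets.\<close>

locale blowup_free =
  fixes V :: "'a set" and N :: "'a \<Rightarrow> 'a set" and r s t \<Delta> :: nat
  assumes finite_V: "finite V"
    and nbr_V: "N v \<subseteq> V"
    and nbr_sym: "u \<in> N v \<Longrightarrow> v \<in> N u"
    and nbr_irrefl: "v \<notin> N v"
    and deg_le: "card (N v) \<le> \<Delta>"
    and r_pos: "1 \<le> r" and s_pos: "1 \<le> s" and t_pos: "1 \<le> t"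
    and few_copies: "\<lbrakk>Y \<subseteq> V; \<And>i. i < r \<Longrightarrow> W i \<subseteq> V \<and> card (W i) = s; disjoint_copies N r W Y z\<rbrakk>
      \<Longrightarrow> card Y < t"
begin

lemma finite_N [simp]: "finite (N v)"
  using finite_V nbr_V finite_subset by blast

definition common :: "'a set \<Rightarrow> 'a set" where
  "common S = {z \<in> V. S \<subseteq> N z}"

text \<open>The number of vertices of the blowup.\<close>

definition heavy :: nat where
  "heavy = t * r + (t + r * s)"

definition light :: "'a set \<Rightarrow> bool" where
  "light S \<longleftrightarrow> card (common S) < heavy"

lemma finite_common [simp]: "finite (common S)"
  using finite_V by (simp add: common_def)

lemma common_mono: "S \<subseteq> T \<Longrightarrow> common T \<subseteq> common S"
  by (auto simp: common_def)

text \<open>If all \<open>(s + 1)\<close>-subsets of \<open>Q\<close> were heavy, any \<open>t\<close> points of \<open>Q\<close> and any \<open>r\<close> disjoint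
  \<open>s\<close>-subsets of the rest would be the centres and the roots of \<open>t\<close> disjoint copies: the middle
  vertices can be picked greedily, as every one of them has at least as many candidates as the whole
  blowup has vertices.\<close>

lemma exists_light_subset:
  assumes "Q \<subseteq> V" "card Q = t + r * s"
  shows "\<exists>S\<subseteq>Q. card S = s + 1 \<and> light S"
proof (rule ccontr)
  assume "\<not> ?thesis"
  then have heavy: "heavy \<le> card (common S)" if "S \<subseteq> Q" "card S = s + 1" for S
    using that by (auto simp: light_def not_less)
  have fQ: "finite Q" using assms finite_V finite_subset by blast
  obtain e where e: "bij_betw e {..<t + r * s} Q"
    using ex_bij_betw_nat_finite[OF fQ] assms(2) by (auto simp: atLeast0LessThan)
  define Y where "Y = e ` {..<t}"
  define W where "W i = e ` {t + i * s..<t + Suc i * s}" for i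
  have inj: "inj_on e {..<t + r * s}" using e by (rule bij_betw_imp_inj_on)
  have block: "{t + i * s..<t + Suc i * s} \<subseteq> {..<t + r * s}" if "i < r" for i
  proof -
    have "Suc i * s \<le> r * s" using that by (intro mult_right_mono) auto
    then show ?thesis by auto
  qed
  have YQ: "Y \<subseteq> Q" using e by (auto simp: Y_def bij_betw_def)
  have WQ: "W i \<subseteq> Q" if "i < r" for i using e block[OF that] unfolding W_def bij_betw_def by blast
  have cY: "card Y = t" unfolding Y_def
    by (subst card_image) (auto intro: inj_on_subset[OF inj])
  have cW: "card (W i) = s" if "i < r" for i
    using card_image[OF inj_on_subset[OF inj block[OF that]]] by (simp add: W_def)
  have YW: "Y \<inter> W i = {}" if "i < r" for i
  proof -
    have "e ` ({..<t} \<inter> {t + i * s..<t + Suc i * s}) = Y \<inter> W i"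
      unfolding Y_def W_def using block[OF that] by (intro inj_on_image_Int[OF inj]) auto
    moreover have "{..<t} \<inter> {t + i * s..<t + Suc i * s} = {}" by auto
    ultimately show ?thesis by simp
  qed
  have WW: "W i \<inter> W j = {}" if "i < j" "j < r" for i j
  proof -
    have "e ` ({t + i * s..<t + Suc i * s} \<inter> {t + j * s..<t + Suc j * s}) = W i \<inter> W j"
      unfolding W_def using block[of i] block[of j] that by (intro inj_on_image_Int[OF inj]) auto
    moreover have "Suc i * s \<le> j * s" using that by (intro mult_right_mono) auto
    then have "{t + i * s..<t + Suc i * s} \<inter> {t + j * s..<t + Suc j * s} = {}"
      unfolding disjoint_iff atLeastLessThan_iff by linarith
    ultimately show ?thesis by (simp only: image_empty)
  qed
  define U where "U = Y \<union> (\<Union>i<r. W i)"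
  have "U \<subseteq> Q" using YQ WQ by (auto simp: U_def)
  then have cU: "card U \<le> t + r * s" and fU: "finite U"
    using card_mono[OF fQ] assms(2) fQ finite_subset by auto
  have "\<exists>f. inj_on f (Y \<times> {..<r}) \<and>
      (\<forall>p\<in>Y \<times> {..<r}. f p \<in> common (insert (fst p) (W (snd p))) - U)"
  proof (rule distinct_representatives_avoiding)
    show "finite (Y \<times> {..<r})" using YQ fQ finite_subset by blast
    fix p assume p: "p \<in> Y \<times> {..<r}"
    then have "fst p \<in> Y" "snd p < r" by auto
    then have "fst p \<in> Q" "W (snd p) \<subseteq> Q" "fst p \<notin> W (snd p)" "card (W (snd p)) = s"
      using YQ WQ[of "snd p"] YW[of "snd p"] cW[of "snd p"] by auto
    moreover from this have "finite (W (snd p))" using fQ finite_subset by blast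
    ultimately have "heavy \<le> card (common (insert (fst p) (W (snd p))))"
      by (intro heavy) auto
    then show "card (Y \<times> {..<r}) + card U \<le> card (common (insert (fst p) (W (snd p))))"
      using cU cY by (simp add: heavy_def card_cartesian_product)
  qed (fact fU)
  then obtain f where f: "inj_on f (Y \<times> {..<r})"
    "\<And>y i. y \<in> Y \<Longrightarrow> i < r \<Longrightarrow> f (y, i) \<in> common (insert y (W i)) - U" by fastforce
  have "disjoint_copies N r W Y (\<lambda>y i. f (y, i))"
    unfolding disjoint_copies_def
  proof (intro conjI allI impI ballI)
    fix i j assume "i < r" "j < r" "i \<noteq> j"
    then show "W i \<inter> W j = {}" using WW[of i j] WW[of j i] by (cases "i < j") auto
  next
    show "Y \<inter> (\<Union>i<r. W i) = {}" using YW by auto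
  next
    fix y i assume "y \<in> Y" "i < r"
    then show "insert y (W i) \<subseteq> N (f (y, i))" "f (y, i) \<notin> Y \<union> (\<Union>i<r. W i)"
      using f(2)[of y i] by (auto simp: common_def U_def)
  next
    show "inj_on (\<lambda>(y, i). f (y, i)) (Y \<times> {..<r})" using f(1) by simp
  qed
  moreover have "W i \<subseteq> V \<and> card (W i) = s" if "i < r" for i
    using WQ[OF that] cW[OF that] assms(1) by blast
  ultimately have "card Y < t" using few_copies[of Y W] YQ assms(1) by blast
  then show False using cY by simp
qed

definition light_subsets :: "'a set \<Rightarrow> 'a set set" where
  "light_subsets P = {S. S \<subseteq> P \<and> card S = s + 1 \<and> light S}"

lemma finite_light_subsets [simp]: "finite P \<Longrightarrow> finite (light_subsets P)"
  by (auto simp: light_subsets_def)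

text \<open>The reciprocal of a lower bound for the density of the light sets.\<close>

definition light_factor :: nat where
  "light_factor = (s + 1) ^ (s + 1) * ((t + r * s) choose (s + 1))"

lemma power_card_le_light_subsets:
  assumes "P \<subseteq> V" "t + r * s \<le> card P"
  shows "card P ^ (s + 1) \<le> light_factor * card (light_subsets P)"
proof -
  have fP: "finite P" using assms finite_V finite_subset by blast
  have "s \<le> r * s" using r_pos by simp
  then have le: "s + 1 \<le> t + r * s" using t_pos by linarith
  have 1: "card P choose (s + 1) \<le> card (light_subsets P) * ((t + r * s) choose (s + 1))"
    unfolding light_subsets_def
    using exists_light_subset assms le
    by (intro choose_le_card_hitting_family[OF fP]) auto
  have "(real (card P) / real (s + 1)) ^ (s + 1) \<le> real (card P choose (s + 1))"
    using assms(2) le by (intro binomial_ge_n_over_k_pow_k) auto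
  then have "real (card P) ^ (s + 1) \<le> real ((s + 1) ^ (s + 1)) * real (card P choose (s + 1))"
    by (simp add: power_divide divide_le_eq mult.commute del: power_Suc of_nat_Suc binomial_Suc_Suc)
  then have "card P ^ (s + 1) \<le> (s + 1) ^ (s + 1) * (card P choose (s + 1))"
    by (metis (mono_tags) of_nat_le_iff of_nat_mult of_nat_power)
  also have "\<dots> \<le> (s + 1) ^ (s + 1) * (card (light_subsets P) * ((t + r * s) choose (s + 1)))"
    using 1 by (rule mult_left_mono) simp
  finally show ?thesis by (simp add: light_factor_def ac_simps)
qed

section \<open>Root sets attached to common centres\<close>

text \<open>For a set \<open>Y\<close> of centres, these are the root sets that can form a branch at every \<open>y \<in> Y\<close>, the
  middle vertex being allowed to depend on \<open>y\<close>.\<close>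

definition roots_at :: "'a set \<Rightarrow> 'a set set" where
  "roots_at Y = {W. W \<subseteq> V \<and> card W = s \<and>
     (\<forall>y\<in>Y. y \<notin> W \<and> light (insert y W) \<and> common (insert y W) \<noteq> {})}"

text \<open>Two root sets at \<open>y\<close> that do not clash are disjoint and have different middle vertices, however
  these are chosen. The middle vertex of one branch may still be a root of the other; such
  coincidences are only excluded when disjoint copies are selected.\<close>

definition clash :: "'a set \<Rightarrow> 'a set \<Rightarrow> 'a set \<Rightarrow> bool" where
  "clash Y W W' \<longleftrightarrow> (\<exists>y\<in>Y. W \<inter> W' \<noteq> {} \<or> common (insert y (W \<union> W')) \<noteq> {})"

definition root_tuples :: "'a set \<Rightarrow> 'a set list set" where
  "root_tuples Y =
     {Ws. length Ws = r \<and> set Ws \<subseteq> roots_at Y \<and> sorted_wrt (\<lambda>W W'. \<not> clash Y W W') Ws}"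

definition centres :: "'a set list \<Rightarrow> 'a set" where
  "centres Ws = {y \<in> V. Ws \<in> root_tuples {y}}"

definition all_tuples :: "'a set list set" where
  "all_tuples = {Ws. set Ws \<subseteq> {W. W \<subseteq> V \<and> card W = s} \<and> length Ws = r}"

lemma finite_roots_at [simp]: "finite (roots_at Y)"
  by (rule finite_subset[of _ "Pow V"]) (auto simp: roots_at_def finite_V)

lemma finite_all_tuples [simp]: "finite all_tuples"
  unfolding all_tuples_def using finite_V by (intro finite_lists_length_eq) auto

lemma root_tuples_subset: "root_tuples Y \<subseteq> all_tuples"
  by (auto simp: root_tuples_def all_tuples_def roots_at_def)

lemma finite_root_tuples [simp]: "finite (root_tuples Y)"
  using finite_subset[OF root_tuples_subset] by simp

lemma finite_centres [simp]: "finite (centres Ws)"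
  using finite_V by (simp add: centres_def)

lemma centres_V: "centres Ws \<subseteq> V"
  by (auto simp: centres_def)

lemma card_all_tuples: "card all_tuples \<le> card V ^ (r * s)"
proof -
  have "card all_tuples = card {W. W \<subseteq> V \<and> card W = s} ^ r"
    unfolding all_tuples_def using finite_V by (intro card_lists_length_eq) auto
  also have "\<dots> \<le> (card V ^ s) ^ r"
    by (intro power_mono card_sets_of_size_le_power finite_V) simp
  finally show ?thesis by (simp add: power_mult[symmetric] mult.commute)
qed

text \<open>All conditions on a root tuple concern one centre at a time. This is what turns a count of
  tuples for each \<open>Y\<close> into a count of subsets \<open>Y\<close> of the centres of each tuple.\<close>

lemma root_tuples_iff:
  assumes "Y \<subseteq> V" "Y \<noteq> {}"
  shows "Ws \<in> root_tuples Y \<longleftrightarrow> Y \<subseteq> centres Ws"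
proof -
  have 1: "set Ws \<subseteq> roots_at Y \<longleftrightarrow> (\<forall>y\<in>Y. set Ws \<subseteq> roots_at {y})"
    using assms(2) by (auto simp: roots_at_def subset_iff)
  have 2: "sorted_wrt (\<lambda>W W'. \<not> clash Y W W') Ws \<longleftrightarrow>
      (\<forall>y\<in>Y. sorted_wrt (\<lambda>W W'. \<not> clash {y} W W') Ws)"
    by (auto simp: sorted_wrt_iff_nth_less clash_def)
  have "Ws \<in> root_tuples Y \<longleftrightarrow> (\<forall>y\<in>Y. Ws \<in> root_tuples {y})"
    using assms(2) by (auto simp: root_tuples_def 1 2)
  also have "\<dots> \<longleftrightarrow> Y \<subseteq> centres Ws" using assms(1) by (auto simp: centres_def)
  finally show ?thesis .
qed

definition clash_bound :: nat where
  "clash_bound = (s + heavy) * \<Delta> ^ s"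

lemma card_sets_in_nbrs_le: "card {W. W \<subseteq> N z \<and> card W = k} \<le> \<Delta> ^ k"
  using card_sets_of_size_le_power[OF finite_N, of z k] deg_le[of z]
  by (meson order_trans power_mono zero_le)

text \<open>A root set that meets \<open>W\<close> in a given point is found by choosing its middle vertex next to \<open>y\<close> and
  its other points next to the middle vertex. One that shares a middle vertex with \<open>W\<close> lies in the
  neighbourhood of one of the common neighbours of \<open>insert y W\<close>, which are few as this set is light.
  In a dense graph a typical centre has of the order of \<open>\<Delta> ^ (s + 1)\<close> root sets, so clashes are rare.\<close>

lemma card_clashing_le:
  assumes "W \<in> roots_at {y}" 
  shows "card {W' \<in> roots_at {y}. clash {y} W' W} \<le> clash_bound"
proof -
  let ?A = "\<Union>w\<in>W. \<Union>z\<in>N y. {W'. W' \<subseteq> N z \<and> card W' = Suc (s - 1) \<and> w \<in> W'}"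
  let ?B = "\<Union>z\<in>common (insert y W). {W'. W' \<subseteq> N z \<and> card W' = s}"
  have cW: "card W = s" and ly: "card (common (insert y W)) \<le> heavy" and fW: "finite W"
    using assms finite_V finite_subset by (auto simp: roots_at_def light_def)
  have through: "card (\<Union>z\<in>N y. {W'. W' \<subseteq> N z \<and> card W' = Suc (s - 1) \<and> w \<in> W'}) \<le> \<Delta> ^ s" for w
  proof -
    have "card {W'. W' \<subseteq> N z \<and> card W' = Suc (s - 1) \<and> w \<in> W'} \<le> \<Delta> ^ (s - 1)" for z
      using card_sets_of_size_through_le_power[OF finite_N, of z "s - 1" w] deg_le[of z]
      by (meson order_trans power_mono zero_le)
    then have "card (\<Union>z\<in>N y. {W'. W' \<subseteq> N z \<and> card W' = Suc (s - 1) \<and> w \<in> W'})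
        \<le> card (N y) * \<Delta> ^ (s - 1)"
      by (intro card_UN_le[THEN order_trans] sum_bounded_above[THEN order_trans]) auto
    also have "\<dots> \<le> \<Delta> * \<Delta> ^ (s - 1)" using deg_le by (intro mult_right_mono) auto
    finally show ?thesis using s_pos by (cases s) auto
  qed
  have "card ?A \<le> (\<Sum>w\<in>W. card (\<Union>z\<in>N y. {W'. W' \<subseteq> N z \<and> card W' = Suc (s - 1) \<and> w \<in> W'}))"
    by (rule card_UN_le[OF fW])
  also have "\<dots> \<le> s * \<Delta> ^ s"
    using through cW by (intro sum_bounded_above[THEN order_trans]) auto
  finally have A: "card ?A \<le> s * \<Delta> ^ s" .
  have "card ?B \<le> (\<Sum>z\<in>common (insert y W). card {W'. W' \<subseteq> N z \<and> card W' = s})"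
    by (rule card_UN_le) simp
  also have "\<dots> \<le> card (common (insert y W)) * \<Delta> ^ s"
    using card_sets_in_nbrs_le by (intro sum_bounded_above[THEN order_trans]) auto
  also have "\<dots> \<le> heavy * \<Delta> ^ s" using ly by (rule mult_right_mono) simp
  finally have B: "card ?B \<le> heavy * \<Delta> ^ s" .
  have "{W' \<in> roots_at {y}. clash {y} W' W} \<subseteq> ?A \<union> ?B"
  proof
    fix W' assume W': "W' \<in> {W' \<in> roots_at {y}. clash {y} W' W}"
    then have c: "card W' = s" "card W' = Suc (s - 1)" and "common (insert y W') \<noteq> {}"
      using s_pos by (auto simp: roots_at_def)
    then obtain z where z: "insert y W' \<subseteq> N z" by (auto simp: common_def)
    from W' consider "W' \<inter> W \<noteq> {}" | "common (insert y (W' \<union> W)) \<noteq> {}" by (auto simp: clash_def)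
    then show "W' \<in> ?A \<union> ?B"
    proof cases
      case 1
      then obtain w where "w \<in> W" "w \<in> W'" by blast
      moreover have "z \<in> N y" "W' \<subseteq> N z" using z nbr_sym by auto
      ultimately show ?thesis using c(2) by blast
    next
      case 2
      then obtain u where "u \<in> common (insert y W)" "W' \<subseteq> N u" by (auto simp: common_def)
      then show ?thesis using c(1) by blast
    qed
  qed
  moreover have "finite (?A \<union> ?B)" using fW by auto
  ultimately have "card {W' \<in> roots_at {y}. clash {y} W' W} \<le> card (?A \<union> ?B)"
    by (rule card_mono[rotated])
  also have "\<dots> \<le> card ?A + card ?B" by (rule card_Un_le)
  finally show ?thesis using A B by (simp add: clash_bound_def algebra_simps)
qed

lemma card_root_tuples_ge:
  assumes "finite Y"
  shows "(card (roots_at Y) - r * (card Y * clash_bound)) ^ r \<le> card (root_tuples Y)"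
  unfolding root_tuples_def
proof (rule card_clash_free_lists)
  fix W assume W: "W \<in> roots_at Y"
  have "{W' \<in> roots_at Y. clash Y W' W} \<subseteq> (\<Union>y\<in>Y. {W' \<in> roots_at {y}. clash {y} W' W})"
    by (auto simp: clash_def roots_at_def)
  then have "card {W' \<in> roots_at Y. clash Y W' W}
      \<le> card (\<Union>y\<in>Y. {W' \<in> roots_at {y}. clash {y} W' W})"
    using assms by (intro card_mono) auto
  also have "\<dots> \<le> (\<Sum>y\<in>Y. card {W' \<in> roots_at {y}. clash {y} W' W})"
    by (rule card_UN_le[OF assms])
  also have "\<dots> \<le> card Y * clash_bound"
  proof (rule sum_bounded_above[THEN order_trans])
    fix y assume "y \<in> Y"
    then show "card {W' \<in> roots_at {y}. clash {y} W' W} \<le> clash_bound"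
      using W by (intro card_clashing_le) (auto simp: roots_at_def)
  qed simp
  finally show "card {W' \<in> roots_at Y. clash Y W' W} \<le> card Y * clash_bound" .
qed simp

section \<open>Many centres for an average tuple of root sets\<close>

text \<open>A light set \<open>S\<close> in the neighbourhood of \<open>z\<close> splits into a centre \<open>y\<close> and a root set, and
  lightness bounds the number of vertices \<open>z\<close> that produce the same pair.\<close>

lemma sum_light_subsets_le_sum_roots_at:
  "(\<Sum>z\<in>V. card (light_subsets (N z))) \<le> heavy * (\<Sum>y\<in>V. card (roots_at {y}))"
proof -
  let ?L = "SIGMA z:V. light_subsets (N z)"
  let ?R = "SIGMA p:(SIGMA y:V. roots_at {y}). common (insert (fst p) (snd p))"
  define c where "c S = (SOME y. y \<in> S)" for S :: "'a set"
  have c: "c S \<in> S" if "card S = s + 1" for S :: "'a set"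
    using that unfolding c_def by (metis add_is_0 card.empty ex_in_conv someI_ex zero_neq_one)
  define f where "f = (\<lambda>(z :: 'a, S). ((c S, S - {c S}), z))"
  have "inj_on f ?L"
  proof (rule inj_onI)
    fix p p' assume p: "p \<in> ?L" "p' \<in> ?L" "f p = f p'"
    obtain z S z' S' where pp: "p = (z, S)" "p' = (z', S')" by fastforce
    have "c S \<in> S" "c S' \<in> S'" using p c unfolding pp by (auto simp: light_subsets_def)
    moreover have "c S = c S'" "S - {c S} = S' - {c S'}" "z = z'"
      using p(3) unfolding pp f_def by auto
    ultimately show "p = p'" unfolding pp by (metis insert_Diff)
  qed
  moreover have "f ` ?L \<subseteq> ?R"
  proof
    fix x assume "x \<in> f ` ?L"
    then obtain z S where x: "x = f (z, S)" "z \<in> V" "S \<subseteq> N z" "card S = s + 1" "light S"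
      by (auto simp: light_subsets_def)
    have cS: "c S \<in> S" "insert (c S) (S - {c S}) = S" using c[OF x(4)] by auto
    then have "card (S - {c S}) = s" using x(4) by simp
    moreover have "z \<in> common S" using x by (simp add: common_def)
    moreover have "S \<subseteq> V" using x(3) nbr_V by (rule subset_trans)
    ultimately show "x \<in> ?R" using x cS by (auto simp: f_def roots_at_def)
  qed
  moreover have "finite ?R" using finite_V by (intro finite_SigmaI) auto
  ultimately have "card ?L \<le> card ?R" by (rule card_inj_on_le)
  also have "card ?R = (\<Sum>p\<in>(SIGMA y:V. roots_at {y}). card (common (insert (fst p) (snd p))))"
    using finite_V by (intro card_SigmaI) auto
  also have "\<dots> \<le> card (SIGMA y:V. roots_at {y}) * heavy"
  proof (rule sum_bounded_above[THEN order_trans])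
    fix p assume "p \<in> (SIGMA y:V. roots_at {y})"
    then have "light (insert (fst p) (snd p))" by (auto simp: roots_at_def)
    then show "card (common (insert (fst p) (snd p))) \<le> heavy" by (simp add: light_def)
  qed simp
  also have "card (SIGMA y:V. roots_at {y}) = (\<Sum>y\<in>V. card (roots_at {y}))"
    using finite_V by simp
  also have "card ?L = (\<Sum>z\<in>V. card (light_subsets (N z)))"
    using finite_V by simp
  finally show ?thesis by (simp add: mult.commute)
qed

lemma sum_degree_power_le:
  "(\<Sum>z\<in>V. card (N z) ^ (s + 1)) \<le>
     light_factor * heavy * (\<Sum>y\<in>V. card (roots_at {y})) + card V * (t + r * s) ^ (s + 1)"
proof -
  have "card (N z) ^ (s + 1) \<le> light_factor * card (light_subsets (N z)) + (t + r * s) ^ (s + 1)" for z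
  proof (cases "t + r * s \<le> card (N z)")
    case True
    then show ?thesis using power_card_le_light_subsets[OF nbr_V] by (meson trans_le_add1)
  next
    case False
    then have "card (N z) ^ (s + 1) \<le> (t + r * s) ^ (s + 1)" by (intro power_mono) auto
    then show ?thesis by linarith
  qed
  then have "(\<Sum>z\<in>V. card (N z) ^ (s + 1))
      \<le> (\<Sum>z\<in>V. light_factor * card (light_subsets (N z)) + (t + r * s) ^ (s + 1))"
    by (intro sum_mono)
  also have "\<dots> = light_factor * (\<Sum>z\<in>V. card (light_subsets (N z))) + card V * (t + r * s) ^ (s + 1)"
    by (simp add: sum.distrib sum_distrib_left)
  also have "light_factor * (\<Sum>z\<in>V. card (light_subsets (N z)))
      \<le> light_factor * (heavy * (\<Sum>y\<in>V. card (roots_at {y})))"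
    using sum_light_subsets_le_sum_roots_at by (rule mult_left_mono) simp
  finally show ?thesis by (simp add: mult.assoc)
qed

lemma sum_card_centres:
  "(\<Sum>Ws\<in>all_tuples. card (centres Ws)) = (\<Sum>y\<in>V. card (root_tuples {y}))"
proof -
  have "(\<Sum>Ws\<in>all_tuples. card (centres Ws))
      = (\<Sum>y\<in>V. card {Ws \<in> all_tuples. Ws \<in> root_tuples {y}})"
    unfolding centres_def using finite_V by (intro sum_card_swap) auto
  moreover have "{Ws \<in> all_tuples. Ws \<in> root_tuples {y}} = root_tuples {y}" for y
    using root_tuples_subset by auto
  ultimately show ?thesis by simp
qed

lemma light_factor_heavy_pos: "1 \<le> light_factor * heavy"
proof -
  have "s \<le> r * s" using r_pos by simp
  then have "s + 1 \<le> t + r * s" using t_pos by linarith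
  then have "0 < (t + r * s) choose (s + 1)" by simp
  then have "0 < light_factor" unfolding light_factor_def by (intro mult_pos_pos) auto
  moreover have "0 < heavy" using t_pos by (simp add: heavy_def)
  ultimately have "0 < light_factor * heavy" by (rule mult_pos_pos)
  then show ?thesis by simp
qed

text \<open>Convexity is used twice: for the \<open>(s + 1)\<close>-subsets of the neighbourhoods of all \<open>z\<close>, and for
  the \<open>r\<close>-tuples of root sets at all \<open>y\<close>. The lower bound on \<open>\<Delta>\<close> makes the clashes negligible, and
  also the small neighbourhoods, which need not contain light sets.\<close>

lemma sum_card_centres_ge:
  fixes \<gamma> n \<delta> :: real
  assumes "0 < \<gamma>" "1 \<le> n" "card V \<le> n" and deg: "\<gamma> * n * \<Delta> \<le> (\<Sum>v\<in>V. card (N v))"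
  defines "\<delta> \<equiv> \<gamma> ^ (s + 1) / (2 * light_factor * heavy)"
  assumes large: "(t + r * s) ^ (s + 1) + r * (s + heavy) \<le> \<delta> * \<Delta>"
  shows "n * (\<delta> * \<Delta> ^ (s + 1)) ^ r \<le> (\<Sum>Ws\<in>all_tuples. card (centres Ws))"
proof -
  let ?D = "real \<Delta>" and ?dh = "real (light_factor * heavy)"
  let ?N0 = "real ((t + r * s) ^ (s + 1))"
  let ?a = "\<lambda>y. real (card (roots_at {y}))"
  have dh: "1 \<le> ?dh" using light_factor_heavy_pos by (metis of_nat_1 of_nat_le_iff)
  have \<delta>: "0 < \<delta>" unfolding \<delta>_def using assms(1) dh
    by (intro divide_pos_pos) (auto simp: mult.assoc)
  have mul: "\<delta> * (2 * ?dh) = \<gamma> ^ (s + 1)" unfolding \<delta>_def using light_factor_heavy_pos by auto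
  have D1: "1 \<le> ?D"
  proof -
    have "0 < (t + r * s) ^ (s + 1)" using t_pos by (intro zero_less_power) simp
    then have "0 < real ((t + r * s) ^ (s + 1) + r * (s + heavy))"
      by (simp only: of_nat_0_less_iff add_pos_nonneg zero_le)
    then have "0 < \<delta> * ?D" using large by linarith
    then show ?thesis using \<delta> by (simp add: zero_less_mult_iff)
  qed
  have n0: "0 < n" using assms(2) by simp
  \<comment> \<open>The average of the powers of the degrees is at least the power of the average degree.\<close>
  have "(\<gamma> * n * ?D) ^ Suc s \<le> (\<Sum>v\<in>V. real (card (N v))) ^ Suc s"
    using deg assms(1) n0 by (intro power_mono) auto
  also have "\<dots> \<le> real (card V) ^ s * (\<Sum>v\<in>V. real (card (N v)) ^ Suc s)"
    by (rule power_mean_sum[OF finite_V]) simp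
  also have "\<dots> \<le> n ^ s * (\<Sum>v\<in>V. real (card (N v)) ^ Suc s)"
    using assms(3) by (intro mult_right_mono power_mono sum_nonneg) auto
  finally have "n ^ s * (n * (\<gamma> * ?D) ^ Suc s) \<le> n ^ s * (\<Sum>v\<in>V. real (card (N v)) ^ Suc s)"
    by (simp add: power_mult_distrib ac_simps)
  then have "n * (\<gamma> * ?D) ^ Suc s \<le> (\<Sum>v\<in>V. real (card (N v)) ^ Suc s)"
    using n0 by simp
  also have "\<dots> = real (\<Sum>v\<in>V. card (N v) ^ (s + 1))" by simp
  also have "\<dots> \<le> real (light_factor * heavy * (\<Sum>y\<in>V. card (roots_at {y})) + card V * (t + r * s) ^ (s + 1))"
    using sum_degree_power_le by (simp only: of_nat_le_iff)
  also have "\<dots> = ?dh * (\<Sum>y\<in>V. ?a y) + real (card V) * ?N0" by simp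
  also have "\<dots> \<le> ?dh * (\<Sum>y\<in>V. ?a y) + n * (?dh * ?N0)"
  proof -
    have "real (card V) * ?N0 \<le> n * (1 * ?N0)" using assms(3) by (simp add: mult_right_mono)
    also have "\<dots> \<le> n * (?dh * ?N0)" using dh n0 by (intro mult_left_mono mult_right_mono) auto
    finally show ?thesis by simp
  qed
  finally have "n * (\<gamma> * ?D) ^ Suc s \<le> ?dh * (\<Sum>y\<in>V. ?a y) + n * (?dh * ?N0)" .
  moreover have "?dh * (n * (2 * \<delta> * ?D ^ (s + 1))) = n * ((\<delta> * (2 * ?dh)) * ?D ^ (s + 1))"
    by (simp only: ac_simps)
  moreover have "n * ((\<delta> * (2 * ?dh)) * ?D ^ (s + 1)) = n * (\<gamma> * ?D) ^ Suc s"
    by (simp only: mul power_mult_distrib Suc_eq_plus1)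
  moreover have "?dh * (\<Sum>y\<in>V. ?a y) + n * (?dh * ?N0) = ?dh * ((\<Sum>y\<in>V. ?a y) + n * ?N0)"
    by (simp only: distrib_left ac_simps)
  ultimately have "?dh * (n * (2 * \<delta> * ?D ^ (s + 1))) \<le> ?dh * ((\<Sum>y\<in>V. ?a y) + n * ?N0)"
    by (simp only:)
  then have "n * (2 * \<delta> * ?D ^ (s + 1)) \<le> (\<Sum>y\<in>V. ?a y) + n * ?N0"
    by (rule mult_left_le_imp_le) (use dh in linarith)
  moreover have "n * (?N0 + real (r * clash_bound)) \<le> n * (\<delta> * ?D ^ (s + 1))"
  proof (rule mult_left_mono)
    have "?N0 + real (r * clash_bound) = ?N0 + real (r * (s + heavy)) * ?D ^ s"
      by (simp add: clash_bound_def)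
    also have "\<dots> \<le> ?N0 * ?D ^ s + real (r * (s + heavy)) * ?D ^ s"
      using mult_left_mono[OF one_le_power[OF D1, of s], of ?N0] by simp
    also have "\<dots> = real ((t + r * s) ^ (s + 1) + r * (s + heavy)) * ?D ^ s"
      by (simp add: algebra_simps)
    also have "\<dots> \<le> (\<delta> * ?D) * ?D ^ s"
      using large by (intro mult_right_mono) auto
    finally show "?N0 + real (r * clash_bound) \<le> \<delta> * ?D ^ (s + 1)" by (simp add: ac_simps)
  qed (use n0 in simp)
  ultimately have "n * (\<delta> * ?D ^ (s + 1)) \<le> (\<Sum>y\<in>V. ?a y) - n * real (r * clash_bound)"
    by (simp add: algebra_simps)
  also have "\<dots> \<le> (\<Sum>y\<in>V. ?a y) - real (card V) * real (r * clash_bound)"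
    using assms(3) by (intro diff_left_mono mult_right_mono) auto
  also have "\<dots> = (\<Sum>y\<in>V. ?a y - real (r * clash_bound))"
    by (simp add: sum_subtractf)
  also have "\<dots> \<le> (\<Sum>y\<in>V. real (card (roots_at {y}) - r * clash_bound))"
    by (intro sum_mono) (simp add: of_nat_diff_if del: of_nat_mult)
  finally have avg: "n * (\<delta> * ?D ^ (s + 1))
      \<le> (\<Sum>y\<in>V. real (card (roots_at {y}) - r * clash_bound))" .
  obtain r' where r': "r = Suc r'" using r_pos by (cases r) auto
  have "n ^ r' * (n * (\<delta> * ?D ^ (s + 1)) ^ r) = (n * (\<delta> * ?D ^ (s + 1))) ^ Suc r'"
    by (simp add: r' power_mult_distrib ac_simps)
  also have "\<dots> \<le> (\<Sum>y\<in>V. real (card (roots_at {y}) - r * clash_bound)) ^ Suc r'"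
    using avg n0 \<delta> by (intro power_mono mult_nonneg_nonneg) auto
  also have "\<dots> \<le> real (card V) ^ r' * (\<Sum>y\<in>V. real (card (roots_at {y}) - r * clash_bound) ^ Suc r')"
    by (rule power_mean_sum[OF finite_V]) simp
  also have "\<dots> \<le> n ^ r' * (\<Sum>y\<in>V. real (card (root_tuples {y})))"
  proof (rule mult_mono)
    show "(\<Sum>y\<in>V. real (card (roots_at {y}) - r * clash_bound) ^ Suc r')
        \<le> (\<Sum>y\<in>V. real (card (root_tuples {y})))"
    proof (rule sum_mono)
      fix y
      have "(card (roots_at {y}) - r * clash_bound) ^ r \<le> card (root_tuples {y})"
        using card_root_tuples_ge[of "{y}"] by simp
      then show "real (card (roots_at {y}) - r * clash_bound) ^ Suc r' \<le> real (card (root_tuples {y}))"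
        unfolding r'[symmetric] of_nat_power[symmetric] of_nat_le_iff .
    qed
  qed (use assms(3) n0 in \<open>auto intro!: power_mono sum_nonneg\<close>)
  finally have "n * (\<delta> * ?D ^ (s + 1)) ^ r \<le> (\<Sum>y\<in>V. real (card (root_tuples {y})))"
    using n0 by simp
  then show ?thesis by (simp add: sum_card_centres flip: of_nat_sum)
qed

section \<open>Centres of a common tuple share a middle vertex\<close>

text \<open>At most \<open>t * (r + 1) + r * s\<close> vertices are covered by \<open>t\<close> copies over common root sets, and a
  centre has \<open>r\<close> middle vertices that can be one of them; the factor 2 accounts for the centres that are
  themselves covered. Above the threshold \<open>many\<close>, a proportion \<open>1 / crowd\<close> of the centres is large
  enough to contain light sets.\<close>

definition crowd :: nat where
  "crowd = 2 * r * (t * (r + 1) + r * s)"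

definition many :: nat where
  "many = crowd * (t + r * s) + 1"

text \<open>Choose a middle vertex for every centre and every root set, and take a maximal family of
  centres whose copies are disjoint from each other and have no middle vertex among the roots.
  It has fewer than \<open>t\<close> members, so its copies and the roots cover boundedly many vertices, and
  every further centre is one of these vertices or has one of them as a middle vertex. The latter
  holds for most centres, and the pigeonhole principle gives a middle vertex shared by many.\<close>

lemma centres_crowd_around_vertex:
  assumes Ws: "Ws \<in> all_tuples" and big: "many \<le> card (centres Ws)"
  shows "\<exists>i<r. \<exists>z. Ws ! i \<subseteq> N z \<and> card (centres Ws) \<le> crowd * card (centres Ws \<inter> N z)"
proof -
  let ?C = "centres Ws" and ?u = "t * (r + 1) + r * s"
  let ?R = "\<Union>i<r. Ws ! i"
  have len: "length Ws = r" using Ws by (simp add: all_tuples_def)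
  have mem: "Ws ! i \<in> set Ws" if "i < r" for i using that len by simp
  have Wi: "Ws ! i \<subseteq> V" "card (Ws ! i) = s" if "i < r" for i
    using Ws mem[OF that] by (auto simp: all_tuples_def)
  have at: "Ws ! i \<in> roots_at {y}" if "y \<in> ?C" "i < r" for y i
    using that(1) mem[OF that(2)] by (auto simp: centres_def root_tuples_def)
  have no_clash: "\<not> clash {y} (Ws ! i) (Ws ! j)" if "y \<in> ?C" "i < j" "j < r" for y i j
    using that len by (auto simp: centres_def root_tuples_def sorted_wrt_iff_nth_less)
  define z where "z y i = (SOME z. z \<in> common (insert y (Ws ! i)))" for y i
  have z: "z y i \<in> common (insert y (Ws ! i))" if "y \<in> ?C" "i < r" for y i
  proof -
    have "common (insert y (Ws ! i)) \<noteq> {}" using at[OF that] by (simp add: roots_at_def)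
    then show ?thesis unfolding z_def by (simp add: some_in_eq)
  qed
  have z_nbr: "insert y (Ws ! i) \<subseteq> N (z y i)" if "y \<in> ?C" "i < r" for y i
    using z[OF that] by (simp add: common_def)
  have z_less: "z y i \<noteq> z y j" if "y \<in> ?C" "i < j" "j < r" for y i j
  proof
    assume "z y i = z y j"
    then have "z y i \<in> common (insert y (Ws ! i \<union> Ws ! j))"
      using z[of y i] z[of y j] that by (auto simp: common_def)
    then show False using no_clash[OF that] by (auto simp: clash_def)
  qed
  have z_inj: "i = j" if "y \<in> ?C" "i < r" "j < r" "z y i = z y j" for y i j
    using z_less[of y i j] z_less[of y j i] that by (metis nat_neq_iff)
  have z_ne: "z y i \<noteq> y" if "y \<in> ?C" "i < r" for y i
    using z_nbr[OF that] nbr_irrefl[of y] by auto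
  have disj: "Ws ! i \<inter> Ws ! j = {}" if "i < r" "j < r" "i \<noteq> j" for i j
  proof -
    have "?C \<noteq> {}" using big by (auto simp: many_def)
    then obtain y where "y \<in> ?C" by blast
    then show ?thesis using no_clash[of y i j] no_clash[of y j i] that
      by (auto simp: clash_def nat_neq_iff)
  qed
  have C_R: "?C \<inter> ?R = {}" using at by (fastforce simp: roots_at_def)
  define copy where "copy y = insert y (z y ` {..<r})" for y
  define indep where "indep T \<longleftrightarrow> T \<subseteq> ?C \<and> (\<forall>y\<in>T. z y ` {..<r} \<inter> ?R = {}) \<and>
      (\<forall>y\<in>T. \<forall>y'\<in>T. y \<noteq> y' \<longrightarrow> copy y \<inter> copy y' = {})" for T
  have indep_small: "card T < t" if "indep T" for T
  proof (rule few_copies)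
    show "T \<subseteq> V" using that centres_V by (auto simp: indep_def)
    show "Ws ! i \<subseteq> V \<and> card (Ws ! i) = s" if "i < r" for i using Wi[OF that] by simp
    show "disjoint_copies N r ((!) Ws) T z"
      unfolding disjoint_copies_def
    proof (intro conjI allI impI ballI)
      fix i j assume "i < r" "j < r" "i \<noteq> j"
      then show "Ws ! i \<inter> Ws ! j = {}" by (rule disj)
    next
      show "T \<inter> ?R = {}" using that C_R by (auto simp: indep_def)
    next
      fix y i assume y: "y \<in> T" "i < r"
      then have yC: "y \<in> ?C" using that by (auto simp: indep_def)
      show "insert y (Ws ! i) \<subseteq> N (z y i)" by (rule z_nbr[OF yC y(2)])
      have "z y i \<notin> T"
      proof
        assume "z y i \<in> T"
        then have "copy y \<inter> copy (z y i) = {}"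
          using that y z_ne[OF yC y(2)] unfolding indep_def by metis
        then show False using y(2) by (auto simp: copy_def)
      qed
      moreover have "z y i \<notin> ?R" using that y unfolding indep_def by blast
      ultimately show "z y i \<notin> T \<union> ?R" by blast
    next
      show "inj_on (\<lambda>(y, i). z y i) (T \<times> {..<r})"
      proof (rule inj_onI)
        fix p q assume pq: "p \<in> T \<times> {..<r}" "q \<in> T \<times> {..<r}"
          and eq: "(\<lambda>(y, i). z y i) p = (\<lambda>(y, i). z y i) q"
        obtain y i y' i' where p: "p = (y, i)" "q = (y', i')" by fastforce
        have y: "y \<in> T" "y' \<in> T" "i < r" "i' < r" "z y i = z y' i'" using pq eq unfolding p by auto
        have "z y i \<in> copy y" using y(3) by (auto simp: copy_def)
        moreover have "z y i \<in> copy y'" unfolding y(5) using y(4) by (auto simp: copy_def)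
        ultimately have "y = y'" using that y(1,2) unfolding indep_def by blast
        then show "p = q" using z_inj[of y i i'] y that unfolding p indep_def by auto
      qed
    qed
  qed
  have "indep {}" by (simp add: indep_def)
  moreover have "\<forall>T. indep T \<longrightarrow> card T < t" using indep_small by blast
  ultimately obtain T where T: "indep T" and T_max: "\<And>T'. indep T' \<Longrightarrow> card T' \<le> card T"
    using ex_has_greatest_nat[of indep "{}" card t] by blast
  have TC: "T \<subseteq> ?C" and fT: "finite T"
    using T finite_subset[OF _ finite_centres] by (auto simp: indep_def)
  define U where "U = (\<Union>y\<in>T. copy y) \<union> ?R"
  have fR: "finite ?R" using Wi(1) finite_V finite_subset by blast
  have fU: "finite U" using fT fR by (auto simp: U_def copy_def)
  have cU: "card U \<le> ?u"
  proof -
    have "card (\<Union>y\<in>T. copy y) \<le> (\<Sum>y\<in>T. card (copy y))" by (rule card_UN_le[OF fT])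
    also have "\<dots> \<le> card T * (r + 1)"
    proof (rule sum_bounded_above[THEN order_trans])
      fix y
      have "card (z y ` {..<r}) \<le> r" using card_image_le[of "{..<r}" "z y"] by simp
      then show "card (copy y) \<le> r + 1" unfolding copy_def
        using card_insert_le_m1[of "r + 1" "z y ` {..<r}" y] by simp
    qed simp
    also have "\<dots> \<le> t * (r + 1)" using indep_small[OF T] by (intro mult_right_mono) auto
    finally have 1: "card (\<Union>y\<in>T. copy y) \<le> t * (r + 1)" .
    have "card ?R \<le> (\<Sum>i<r. card (Ws ! i))" by (rule card_UN_le) simp
    also have "\<dots> = r * s" using Wi(2) by simp
    finally show ?thesis unfolding U_def
      using 1 card_Un_le[of "\<Union>y\<in>T. copy y" ?R] by linarith
  qed
  have hits: "y \<in> U \<or> (\<exists>i<r. z y i \<in> U)" if y: "y \<in> ?C" for y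
  proof (rule ccontr)
    assume not: "\<not> ?thesis"
    then have off: "copy y \<inter> U = {}" by (auto simp: copy_def)
    have "y \<notin> T" using not by (auto simp: U_def copy_def)
    have "indep (insert y T)"
      unfolding indep_def
    proof (intro conjI ballI impI)
      show "insert y T \<subseteq> ?C" using y TC by simp
    next
      fix x assume "x \<in> insert y T"
      then show "z x ` {..<r} \<inter> ?R = {}"
      proof
        assume "x = y"
        then show ?thesis using off unfolding U_def copy_def by blast
      next
        assume "x \<in> T"
        then show ?thesis using T unfolding indep_def by blast
      qed
    next
      fix x x' assume x: "x \<in> insert y T" "x' \<in> insert y T" "x \<noteq> x'"
      have yT: "copy y \<inter> copy v = {}" if "v \<in> T" for v
        using off that unfolding U_def by blast
      consider "x = y" "x' \<in> T" | "x \<in> T" "x' = y" | "x \<in> T" "x' \<in> T" using x by blast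
      then show "copy x \<inter> copy x' = {}"
      proof cases
        case 1
        then show ?thesis using yT by simp
      next
        case 2
        then show ?thesis using yT by (simp add: Int_commute)
      next
        case 3
        then show ?thesis using T x(3) unfolding indep_def by blast
      qed
    qed
    then have "card (insert y T) \<le> card T" by (rule T_max)
    then show False using \<open>y \<notin> T\<close> fT by simp
  qed
  let ?I = "{..<r} \<times> U"
  let ?D = "\<lambda>p. {y \<in> ?C. z y (fst p) = snd p}"
  have "?C \<subseteq> U \<union> (\<Union>p\<in>?I. ?D p)"
  proof
    fix y assume y: "y \<in> ?C"
    show "y \<in> U \<union> (\<Union>p\<in>?I. ?D p)"
    proof (cases "y \<in> U")
      case False
      then obtain i where "i < r" "z y i \<in> U" using hits[OF y] by blast
      then have "(i, z y i) \<in> ?I" "y \<in> ?D (i, z y i)" using y by auto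
      then show ?thesis by blast
    qed simp
  qed
  then have "card ?C \<le> card (U \<union> (\<Union>p\<in>?I. ?D p))"
    using fU by (intro card_mono) auto
  also have "\<dots> \<le> card U + (\<Sum>p\<in>?I. card (?D p))"
    using card_Un_le[of U "\<Union>p\<in>?I. ?D p"] card_UN_le[of ?I ?D] fU by simp
  finally have cover: "card ?C \<le> ?u + (\<Sum>p\<in>?I. card (?D p))" using cU by linarith
  have "\<exists>p\<in>?I. card ?C \<le> crowd * card (?D p)"
  proof (rule ccontr)
    assume "\<not> ?thesis"
    then have "crowd * card (?D p) \<le> card ?C" if "p \<in> ?I" for p
      using that by (meson nat_le_linear)
    then have "(\<Sum>p\<in>?I. crowd * card (?D p)) \<le> card ?I * card ?C"
      using sum_bounded_above[of ?I "\<lambda>p. crowd * card (?D p)" "card ?C"] by simp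
    also have "\<dots> \<le> (r * ?u) * card ?C"
      using cU by (intro mult_right_mono) (auto simp: card_cartesian_product)
    finally have "crowd * (\<Sum>p\<in>?I. card (?D p)) \<le> (r * ?u) * card ?C"
      by (simp only: sum_distrib_left)
    moreover have "crowd = (r * ?u) * 2" by (simp only: crowd_def ac_simps)
    ultimately have cancel: "(r * ?u) * (2 * (\<Sum>p\<in>?I. card (?D p))) \<le> (r * ?u) * card ?C"
      by (simp only: mult.assoc)
    have ru: "0 < r * ?u" using r_pos t_pos by simp
    have "2 * (\<Sum>p\<in>?I. card (?D p)) \<le> card ?C"
      by (rule iffD1[OF nat_mult_le_cancel1[OF ru] cancel])
    moreover have "2 * x \<le> k \<Longrightarrow> k \<le> v + x \<Longrightarrow> k \<le> 2 * v" for x k v :: nat by linarith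
    ultimately have "card ?C \<le> 2 * ?u" using cover by blast
    moreover have "2 * ?u \<le> crowd * (t + r * s)"
    proof -
      have "1 * (2 * ?u) * 1 \<le> r * (2 * ?u) * (t + r * s)"
        using r_pos t_pos by (intro mult_mono) auto
      then show ?thesis by (simp add: crowd_def ac_simps)
    qed
    ultimately show False using big by (simp add: many_def)
  qed
  then obtain i u where iu: "i < r" "u \<in> U" "card ?C \<le> crowd * card (?D (i, u))" by auto
  have "?D (i, u) \<noteq> {}"
  proof
    assume "?D (i, u) = {}"
    then have "card ?C = 0" using iu(3) by (simp only: card.empty mult_0_right le_zero_eq)
    then show False using big by (simp add: many_def)
  qed
  then obtain y where "y \<in> ?C" "z y i = u" by auto
  then have "Ws ! i \<subseteq> N u" using z_nbr[of y i] iu(1) by auto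
  moreover have "card ?C \<le> crowd * card (?C \<inter> N u)"
  proof -
    have "?D (i, u) \<subseteq> ?C \<inter> N u" using z_nbr iu(1) by auto
    then have "card (?D (i, u)) \<le> card (?C \<inter> N u)" by (intro card_mono) auto
    then have "crowd * card (?D (i, u)) \<le> crowd * card (?C \<inter> N u)" by (rule mult_left_mono) simp
    then show ?thesis using iu(3) by linarith
  qed
  ultimately show ?thesis using iu(1) by blast
qed

definition shared :: "'a set list \<Rightarrow> 'a set \<Rightarrow> bool" where
  "shared Ws Y \<longleftrightarrow> (\<exists>i<r. common (Y \<union> Ws ! i) \<noteq> {})"

text \<open>Light sets are dense among the centres that crowd around one vertex. The linear term accounts
  for the tuples with too few centres.\<close>

lemma power_card_centres_le:
  assumes "Ws \<in> all_tuples"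
  shows "card (centres Ws) ^ (s + 1) \<le>
     crowd ^ (s + 1) * light_factor * card {Y \<in> light_subsets (centres Ws). shared Ws Y}
     + many ^ s * card (centres Ws)"
proof (cases "many \<le> card (centres Ws)")
  case True
  then obtain i z where iz: "i < r" "Ws ! i \<subseteq> N z"
    and le: "card (centres Ws) \<le> crowd * card (centres Ws \<inter> N z)"
    using centres_crowd_around_vertex[OF assms] by blast
  have "crowd * (t + r * s) \<le> crowd * card (centres Ws \<inter> N z)"
    using True le unfolding many_def by linarith
  moreover have "0 < crowd" using r_pos t_pos by (simp add: crowd_def)
  ultimately have large: "t + r * s \<le> card (centres Ws \<inter> N z)" by simp
  have sub: "centres Ws \<inter> N z \<subseteq> V" using nbr_V by blast
  have "light_subsets (centres Ws \<inter> N z) \<subseteq> {Y \<in> light_subsets (centres Ws). shared Ws Y}"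
  proof
    fix Y assume Y: "Y \<in> light_subsets (centres Ws \<inter> N z)"
    have "Ws ! i \<in> set Ws" using assms iz(1) by (simp add: all_tuples_def)
    then have "card (Ws ! i) = s" using assms by (auto simp: all_tuples_def)
    then have "Ws ! i \<noteq> {}" using s_pos by auto
    then obtain w where "w \<in> N z" using iz(2) by blast
    then have "z \<in> V" using nbr_sym nbr_V by blast
    then have "z \<in> common (Y \<union> Ws ! i)"
      using Y iz(2) by (auto simp: common_def light_subsets_def)
    then show "Y \<in> {Y \<in> light_subsets (centres Ws). shared Ws Y}"
      using Y iz(1) by (auto simp: light_subsets_def shared_def)
  qed
  then have count: "card (light_subsets (centres Ws \<inter> N z))
      \<le> card {Y \<in> light_subsets (centres Ws). shared Ws Y}"
    by (intro card_mono) auto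
  have "card (centres Ws) ^ (s + 1) \<le> (crowd * card (centres Ws \<inter> N z)) ^ (s + 1)"
    using le by (rule power_mono) simp
  also have "\<dots> = crowd ^ (s + 1) * card (centres Ws \<inter> N z) ^ (s + 1)"
    by (rule power_mult_distrib)
  also have "\<dots> \<le> crowd ^ (s + 1) * (light_factor * card (light_subsets (centres Ws \<inter> N z)))"
    using power_card_le_light_subsets[OF sub large] by (rule mult_left_mono) simp
  also have "\<dots> \<le> crowd ^ (s + 1) * (light_factor * card {Y \<in> light_subsets (centres Ws). shared Ws Y})"
    using count by (intro mult_left_mono) auto
  finally show ?thesis by (simp only: mult.assoc trans_le_add1)
next
  case False
  then have "card (centres Ws) ^ s \<le> many ^ s" by (intro power_mono) auto
  then have "card (centres Ws) ^ s * card (centres Ws) \<le> many ^ s * card (centres Ws)"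
    by (rule mult_right_mono) simp
  then show ?thesis by (simp only: power_add power_one_right trans_le_add2)
qed

section \<open>Few centres share a middle vertex\<close>

text \<open>If \<open>Y\<close> and a root set have a common neighbour, it is one of the few common neighbours of the
  light set \<open>Y\<close>, and the root set is an \<open>s\<close>-subset of its neighbourhood.\<close>

lemma card_shared_root_tuples_le:
  assumes Y: "Y \<in> light_subsets V"
  shows "card {Ws \<in> root_tuples Y. shared Ws Y} \<le>
    (if common Y = {} then 0 else r * (heavy * \<Delta> ^ s) * card (roots_at Y) ^ (r - 1))"
proof (cases "common Y = {}")
  case True
  then have "\<not> shared Ws Y" for Ws
    using common_mono[of Y "Y \<union> Ws ! i" for i] by (fastforce simp: shared_def)
  then show ?thesis by simp
next
  case False
  define G where "G = {W \<in> roots_at Y. common (Y \<union> W) \<noteq> {}}"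
  have "G \<subseteq> (\<Union>z\<in>common Y. {W. W \<subseteq> N z \<and> card W = s})"
    by (auto simp: G_def roots_at_def common_def)
  then have "card G \<le> card (\<Union>z\<in>common Y. {W. W \<subseteq> N z \<and> card W = s})"
    by (intro card_mono) auto
  also have "\<dots> \<le> (\<Sum>z\<in>common Y. card {W. W \<subseteq> N z \<and> card W = s})"
    by (rule card_UN_le) simp
  also have "\<dots> \<le> card (common Y) * \<Delta> ^ s"
    using card_sets_in_nbrs_le by (intro sum_bounded_above[THEN order_trans]) auto
  also have "\<dots> \<le> heavy * \<Delta> ^ s"
    using Y by (intro mult_right_mono) (auto simp: light_subsets_def light_def)
  finally have G: "card G \<le> heavy * \<Delta> ^ s" .
  let ?S = "\<lambda>i. {Ws. length Ws = r \<and> set Ws \<subseteq> roots_at Y \<and> Ws ! i \<in> G}"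
  have finS: "finite (?S i)" for i
    by (rule finite_subset[OF _ finite_lists_length_eq[OF finite_roots_at, of Y r]]) auto
  have "{Ws \<in> root_tuples Y. shared Ws Y} \<subseteq> (\<Union>i<r. ?S i)"
  proof
    fix Ws assume Ws: "Ws \<in> {Ws \<in> root_tuples Y. shared Ws Y}"
    then obtain i where i: "i < r" "common (Y \<union> Ws ! i) \<noteq> {}" by (auto simp: shared_def)
    have len: "length Ws = r" "set Ws \<subseteq> roots_at Y" using Ws by (auto simp: root_tuples_def)
    then have "Ws ! i \<in> roots_at Y" using i(1) by (metis nth_mem subsetD)
    then have "Ws \<in> ?S i" using i len by (simp add: G_def)
    then show "Ws \<in> (\<Union>i<r. ?S i)" using i(1) by blast
  qed
  then have "card {Ws \<in> root_tuples Y. shared Ws Y} \<le> card (\<Union>i<r. ?S i)"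
    using finS by (intro card_mono) auto
  also have "\<dots> \<le> (\<Sum>i<r. card (?S i))" by (rule card_UN_le) simp
  also have "\<dots> \<le> card {..<r} * (card G * card (roots_at Y) ^ (r - 1))"
  proof (rule sum_bounded_above[THEN order_trans])
    fix i assume "i \<in> {..<r}"
    then show "card (?S i) \<le> card G * card (roots_at Y) ^ (r - 1)"
      by (intro card_lists_with_entry) (auto simp: G_def)
  qed simp
  also have "\<dots> = r * card G * card (roots_at Y) ^ (r - 1)" by simp
  also have "\<dots> \<le> r * (heavy * \<Delta> ^ s) * card (roots_at Y) ^ (r - 1)"
    using G by (intro mult_right_mono mult_left_mono) auto
  finally show ?thesis using False by simp
qed

text \<open>With more than \<open>spread E * \<Delta> ^ s\<close> root sets at \<open>Y\<close>, clashes exclude at most half of the choices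
  for each entry of a tuple, by the first summand, and the root sets that have a common neighbour with
  \<open>Y\<close> are a minority, by the second one.\<close>

definition spread :: "nat \<Rightarrow> nat" where
  "spread E = 2 * r * (s + 1) * (s + heavy) + E * r * heavy * 2 ^ r"

text \<open>A light set \<open>Y\<close> with at most \<open>spread E * \<Delta> ^ s\<close> root sets has few root tuples at all. If it
  has more, a positive proportion of the lists of \<open>r\<close> root sets are root tuples for \<open>Y\<close>, whereas at
  most \<open>heavy * \<Delta> ^ s\<close> of the root sets have a common neighbour with \<open>Y\<close>.\<close>

lemma shared_root_tuples_few_or_rare:
  assumes Y: "Y \<in> light_subsets V"
  shows "E * card {Ws \<in> root_tuples Y. shared Ws Y} \<le>
    (if common Y = {} then 0 else E * r * heavy * spread E ^ (r - 1) * \<Delta> ^ (s * r))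
    + card (root_tuples Y)"
proof (cases "common Y = {}")
  case True
  have "card {Ws \<in> root_tuples Y. shared Ws Y} \<le> 0"
    using card_shared_root_tuples_le[OF Y] unfolding if_P[OF True] .
  then show ?thesis by (simp only: le_zero_eq mult_0_right zero_le)
next
  case False
  let ?q = "card (roots_at Y)" and ?sh = "card {Ws \<in> root_tuples Y. shared Ws Y}"
  obtain r' where r': "r = Suc r'" using r_pos by (cases r) auto
  have sh: "?sh \<le> r * (heavy * \<Delta> ^ s) * ?q ^ r'"
    using card_shared_root_tuples_le[OF Y] False by (simp add: r')
  show ?thesis
  proof (cases "?q \<le> spread E * \<Delta> ^ s")
    case True
    have "E * ?sh \<le> E * (r * (heavy * \<Delta> ^ s) * ?q ^ r')" using sh by (rule mult_left_mono) simp
    also have "\<dots> \<le> E * (r * (heavy * \<Delta> ^ s) * (spread E * \<Delta> ^ s) ^ r')"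
      using True by (intro mult_left_mono power_mono) auto
    also have "\<dots> = E * r * heavy * spread E ^ (r - 1) * \<Delta> ^ (s * r)"
    proof -
      have "(spread E * \<Delta> ^ s) ^ r' = spread E ^ (r - 1) * \<Delta> ^ (s * r')"
        by (simp add: r' power_mult_distrib power_mult)
      moreover have "\<Delta> ^ (s * r) = \<Delta> ^ s * \<Delta> ^ (s * r')" by (simp add: r' power_add)
      ultimately show ?thesis by (simp only: ac_simps)
    qed
    finally show ?thesis unfolding if_not_P[OF False] by (rule trans_le_add1)
  next
    case False
    then have q: "spread E * \<Delta> ^ s \<le> ?q" by simp
    have fY: "finite Y" and cY: "card Y = s + 1"
      using Y finite_V finite_subset by (auto simp: light_subsets_def)
    have "2 * (r * (card Y * clash_bound)) = 2 * r * (s + 1) * (s + heavy) * \<Delta> ^ s"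
      by (simp only: cY clash_bound_def ac_simps)
    also have "\<dots> \<le> spread E * \<Delta> ^ s" by (intro mult_right_mono) (auto simp: spread_def)
    also note q
    finally have half: "?q \<le> 2 * (?q - r * (card Y * clash_bound))" by simp
    have "E * r * heavy * 2 ^ r * \<Delta> ^ s \<le> spread E * \<Delta> ^ s"
      by (intro mult_right_mono) (auto simp: spread_def)
    then have rare: "E * r * heavy * 2 ^ r * \<Delta> ^ s \<le> ?q" using q by linarith
    have "2 ^ r * (E * ?sh) \<le> 2 ^ r * (E * (r * (heavy * \<Delta> ^ s) * ?q ^ r'))"
      using sh by (intro mult_left_mono) auto
    also have "\<dots> = (E * r * heavy * 2 ^ r * \<Delta> ^ s) * ?q ^ r'" by (simp only: ac_simps)
    also have "\<dots> \<le> ?q * ?q ^ r'" using rare by (rule mult_right_mono) simp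
    also have "\<dots> = ?q ^ r" by (simp add: r')
    also have "\<dots> \<le> (2 * (?q - r * (card Y * clash_bound))) ^ r" using half by (rule power_mono) simp
    also have "\<dots> = 2 ^ r * (?q - r * (card Y * clash_bound)) ^ r" by (rule power_mult_distrib)
    also have "\<dots> \<le> 2 ^ r * card (root_tuples Y)"
      using card_root_tuples_ge[OF fY] by (rule mult_left_mono) simp
    finally have "E * ?sh \<le> card (root_tuples Y)" by simp
    then show ?thesis by (rule trans_le_add2)
  qed
qed

lemma card_light_subsets_with_common_le:
  "card {Y \<in> light_subsets V. common Y \<noteq> {}} \<le> card V * \<Delta> ^ (s + 1)"
proof -
  have "{Y \<in> light_subsets V. common Y \<noteq> {}} \<subseteq> (\<Union>z\<in>V. {Y. Y \<subseteq> N z \<and> card Y = s + 1})"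
    by (auto simp: light_subsets_def common_def)
  then have "card {Y \<in> light_subsets V. common Y \<noteq> {}}
      \<le> card (\<Union>z\<in>V. {Y. Y \<subseteq> N z \<and> card Y = s + 1})"
    using finite_V by (intro card_mono) auto
  also have "\<dots> \<le> (\<Sum>z\<in>V. card {Y. Y \<subseteq> N z \<and> card Y = s + 1})"
    by (rule card_UN_le[OF finite_V])
  also have "\<dots> \<le> card V * \<Delta> ^ (s + 1)"
    using card_sets_in_nbrs_le by (intro sum_bounded_above[THEN order_trans]) auto
  finally show ?thesis .
qed

definition excess :: nat where
  "excess = 2 * (crowd ^ (s + 1) * light_factor)"

definition moment_const :: nat where
  "moment_const = excess * r * heavy * spread excess ^ (r - 1)"

text \<open>The sum of \<open>card (centres Ws) ^ (s + 1)\<close> is controlled, up to a linear term, by the number of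
  pairs of a root tuple and a light set of its centres that share a middle vertex. Counted from the
  light sets, their contribution is at most half of the sum to be estimated plus a remainder, which is
  small because few light sets have a common neighbour.\<close>

lemma sum_power_card_centres_le:
  "(\<Sum>Ws\<in>all_tuples. card (centres Ws) ^ (s + 1)) \<le>
     moment_const * card V * \<Delta> ^ (s * r + s + 1)
     + 2 * many ^ s * (\<Sum>Ws\<in>all_tuples. card (centres Ws))"
proof -
  let ?\<Phi> = "\<Sum>Ws\<in>all_tuples. card (centres Ws) ^ (s + 1)"
  let ?M = "\<Sum>Ws\<in>all_tuples. card (centres Ws)"
  let ?L = "light_subsets V"
  let ?sh = "\<lambda>Y. card {Ws \<in> root_tuples Y. shared Ws Y}"
  let ?c = "excess * r * heavy * spread excess ^ (r - 1) * \<Delta> ^ (s * r)"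
  have finL: "finite ?L" using finite_V by simp
  have tuples: "Ws \<in> root_tuples Y \<longleftrightarrow> Y \<subseteq> centres Ws" if "Y \<in> ?L" for Y Ws
    using that by (intro root_tuples_iff) (auto simp: light_subsets_def)
  have sub: "light_subsets (centres Ws) = {Y \<in> ?L. Y \<subseteq> centres Ws}" for Ws
    using centres_V by (auto simp: light_subsets_def)
  define \<tau> where "\<tau> = (\<Sum>Y\<in>?L. ?sh Y)"
  have "(\<Sum>Ws\<in>all_tuples. card {Y \<in> light_subsets (centres Ws). shared Ws Y})
      = (\<Sum>Ws\<in>all_tuples. card {Y \<in> ?L. Y \<subseteq> centres Ws \<and> shared Ws Y})"
    by (simp add: sub conj_assoc)
  also have "\<dots> = (\<Sum>Y\<in>?L. card {Ws \<in> all_tuples. Y \<subseteq> centres Ws \<and> shared Ws Y})"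
    using finL by (intro sum_card_swap) auto
  also have "\<dots> = \<tau>"
    unfolding \<tau>_def
  proof (rule sum.cong[OF refl])
    fix Y assume "Y \<in> ?L"
    then have "{Ws \<in> all_tuples. Y \<subseteq> centres Ws \<and> shared Ws Y} = {Ws \<in> root_tuples Y. shared Ws Y}"
      using tuples root_tuples_subset by blast
    then show "card {Ws \<in> all_tuples. Y \<subseteq> centres Ws \<and> shared Ws Y} = ?sh Y" by simp
  qed
  finally have swap: "(\<Sum>Ws\<in>all_tuples. card {Y \<in> light_subsets (centres Ws). shared Ws Y}) = \<tau>" .
  have "?\<Phi> \<le> (\<Sum>Ws\<in>all_tuples. crowd ^ (s + 1) * light_factor
        * card {Y \<in> light_subsets (centres Ws). shared Ws Y} + many ^ s * card (centres Ws))"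
    by (intro sum_mono power_card_centres_le)
  also have "\<dots> = crowd ^ (s + 1) * light_factor * \<tau> + many ^ s * ?M"
    by (simp only: sum.distrib swap flip: sum_distrib_left)
  finally have upper: "2 * ?\<Phi> \<le> excess * \<tau> + 2 * many ^ s * ?M" by (simp add: excess_def)
  have pairs: "(\<Sum>Y\<in>?L. card (root_tuples Y)) \<le> ?\<Phi>"
  proof -
    have "(\<Sum>Y\<in>?L. card (root_tuples Y)) = (\<Sum>Y\<in>?L. card {Ws \<in> all_tuples. Y \<subseteq> centres Ws})"
    proof (rule sum.cong[OF refl])
      fix Y assume "Y \<in> ?L"
      then have "root_tuples Y = {Ws \<in> all_tuples. Y \<subseteq> centres Ws}"
        using tuples root_tuples_subset by blast
      then show "card (root_tuples Y) = card {Ws \<in> all_tuples. Y \<subseteq> centres Ws}" by simp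
    qed
    also have "\<dots> = (\<Sum>Ws\<in>all_tuples. card {Y \<in> ?L. Y \<subseteq> centres Ws})"
      using finL by (intro sum_card_swap) auto
    also have "\<dots> \<le> ?\<Phi>"
    proof (rule sum_mono)
      fix Ws
      have "{Y \<in> ?L. Y \<subseteq> centres Ws} \<subseteq> {Y. Y \<subseteq> centres Ws \<and> card Y = s + 1}"
        by (auto simp: light_subsets_def)
      then have "card {Y \<in> ?L. Y \<subseteq> centres Ws} \<le> card {Y. Y \<subseteq> centres Ws \<and> card Y = s + 1}"
        by (intro card_mono) auto
      also have "\<dots> \<le> card (centres Ws) ^ (s + 1)"
        by (rule card_sets_of_size_le_power) simp
      finally show "card {Y \<in> ?L. Y \<subseteq> centres Ws} \<le> card (centres Ws) ^ (s + 1)" .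
    qed
    finally show ?thesis .
  qed
  have "excess * \<tau> = (\<Sum>Y\<in>?L. excess * ?sh Y)" by (simp add: \<tau>_def sum_distrib_left)
  also have "\<dots> \<le> (\<Sum>Y\<in>?L. (if common Y = {} then 0 else ?c) + card (root_tuples Y))"
    by (intro sum_mono shared_root_tuples_few_or_rare)
  also have "\<dots> = (\<Sum>Y\<in>?L. if common Y = {} then 0 else ?c) + (\<Sum>Y\<in>?L. card (root_tuples Y))"
    by (rule sum.distrib)
  also have "(\<Sum>Y\<in>?L. if common Y = {} then 0 else ?c) = card {Y \<in> ?L. common Y \<noteq> {}} * ?c"
    using finL by (simp add: sum.If_cases Int_def)
  also have "\<dots> \<le> card V * \<Delta> ^ (s + 1) * ?c"
    using card_light_subsets_with_common_le by (rule mult_right_mono) simp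
  also have "\<dots> = moment_const * card V * \<Delta> ^ (s * r + s + 1)"
    by (simp add: moment_const_def power_add ac_simps)
  finally show ?thesis using upper pairs by linarith
qed

section \<open>Dense graphs of bounded degree contain the blowup\<close>

text \<open>If the degree sum were larger, a tuple would have at least \<open>\<delta> ^ r * C\<close> centres on average. The
  first condition on \<open>C\<close> makes the linear term of the moment bound negligible; what remains
  bounds the moment by a constant multiple of \<open>n * \<Delta> ^ (r * (s + 1))\<close>, and this is too small by the
  second condition on \<open>C\<close>.\<close>

lemma degree_sum_lt:
  fixes \<gamma> n \<delta> C :: real
  assumes "0 < \<gamma>" "1 \<le> n" "card V \<le> n" "s + 1 \<le> r"
  defines "\<delta> \<equiv> \<gamma> ^ (s + 1) / (2 * light_factor * heavy)"
  assumes large: "(t + r * s) ^ (s + 1) + r * (s + heavy) \<le> \<delta> * \<Delta>"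
    and C: "4 * many \<le> \<delta> ^ r * C" "2 * moment_const < \<delta> ^ r * (\<delta> ^ r * C)"
    and dense: "C * n ^ (r * s) \<le> n * \<Delta> ^ (r * (s + 1))"
  shows "(\<Sum>v\<in>V. card (N v)) < \<gamma> * n * \<Delta>"
proof (rule ccontr)
  assume "\<not> ?thesis"
  then have deg: "\<gamma> * n * \<Delta> \<le> (\<Sum>v\<in>V. card (N v))" by simp
  define D M \<Phi> P m0 where "D = real \<Delta>"
    and "M = real (\<Sum>Ws\<in>all_tuples. card (centres Ws))"
    and "\<Phi> = real (\<Sum>Ws\<in>all_tuples. card (centres Ws) ^ (s + 1))"
    and "P = n ^ (r * s)" and "m0 = \<delta> ^ r * C"
  have \<delta>: "0 < \<delta>" unfolding \<delta>_def using assms(1) light_factor_heavy_pos by auto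
  have n: "0 < n" using assms(2) by simp
  then have P: "0 < P" by (simp add: P_def)
  have D: "1 \<le> D"
  proof -
    have "0 < (t + r * s) ^ (s + 1)" using t_pos by (intro zero_less_power) simp
    then have "0 < real ((t + r * s) ^ (s + 1) + r * (s + heavy))"
      by (simp only: of_nat_0_less_iff add_pos_nonneg zero_le)
    then have "0 < \<delta> * D" using large by (simp add: D_def)
    then show ?thesis using \<delta> by (simp add: zero_less_mult_iff D_def)
  qed
  have first: "n * (\<delta> ^ r * D ^ (r * (s + 1))) \<le> M"
  proof -
    have "n * (\<delta> * D ^ (s + 1)) ^ r \<le> M"
      using sum_card_centres_ge[OF assms(1-3) deg large[unfolded \<delta>_def]]
      unfolding M_def D_def \<delta>_def by (simp only: of_nat_power)
    moreover have "(\<delta> * D ^ (s + 1)) ^ r = \<delta> ^ r * D ^ (r * (s + 1))"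
      by (simp only: power_mult_distrib power_mult[symmetric] mult.commute)
    ultimately show ?thesis by simp
  qed
  have "m0 * P = \<delta> ^ r * (C * n ^ (r * s))" by (simp add: m0_def P_def)
  also have "\<dots> \<le> \<delta> ^ r * (n * D ^ (r * (s + 1)))"
    using dense \<delta> by (intro mult_left_mono) (auto simp: D_def)
  also have "\<dots> \<le> M" using first by (simp add: ac_simps)
  finally have MP: "m0 * P \<le> M" .
  have "1 \<le> real many" by (simp add: many_def)
  then have m0: "4 * real many \<le> m0" "1 \<le> m0"
    using C(1) by (simp_all add: m0_def)
  have M: "0 < M" using MP P m0(2) by (meson less_le_trans mult_pos_pos zero_less_one)
  \<comment> \<open>The number of tuples is at most \<open>P\<close>, so the power mean inequality gives the next bound.\<close>
  have "M ^ Suc s \<le> real (card all_tuples) ^ s * \<Phi>"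
    using power_mean_sum[of all_tuples "\<lambda>Ws. real (card (centres Ws))" s]
    by (simp add: M_def \<Phi>_def)
  also have "\<dots> \<le> P ^ s * \<Phi>"
  proof (intro mult_right_mono power_mono)
    have "real (card all_tuples) \<le> real (card V) ^ (r * s)"
      using card_all_tuples by (metis of_nat_le_iff of_nat_power)
    also have "\<dots> \<le> P" unfolding P_def using assms(3) by (intro power_mono) auto
    finally show "real (card all_tuples) \<le> P" .
  qed (auto simp: \<Phi>_def intro!: sum_nonneg)
  finally have pm: "M ^ Suc s \<le> P ^ s * \<Phi>" .
  have "P ^ s * (m0 ^ s * M) = (m0 * P) ^ s * M" by (simp add: power_mult_distrib)
  also have "\<dots> \<le> M ^ s * M" using MP P m0(2) M by (intro mult_right_mono power_mono) auto
  also have "\<dots> \<le> P ^ s * \<Phi>" using pm by (simp add: mult.commute)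
  finally have big: "m0 ^ s * M \<le> \<Phi>" using P by simp
  have "4 * real many ^ s \<le> 4 ^ s * real many ^ s"
    using s_pos power_increasing[of 1 s "4::real"] by (intro mult_right_mono) auto
  also have "\<dots> = (4 * real many) ^ s" by (rule power_mult_distrib[symmetric])
  also have "\<dots> \<le> m0 ^ s" using m0(1) by (rule power_mono) simp
  finally have "4 * real many ^ s * M \<le> m0 ^ s * M"
    using M by (intro mult_right_mono) auto
  then have "4 * real many ^ s * M \<le> \<Phi>" using big by linarith
  moreover have "\<Phi> \<le> moment_const * (real (card V) * D ^ (s * r + s + 1)) + 2 * real many ^ s * M"
    using sum_power_card_centres_le
    unfolding \<Phi>_def M_def D_def of_nat_le_iff[where 'a = real, symmetric] by (simp add: ac_simps)
  moreover have "moment_const * (real (card V) * D ^ (s * r + s + 1))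
      \<le> moment_const * (n * D ^ (r * (s + 1)))"
  proof (intro mult_left_mono mult_mono power_increasing)
    show "s * r + s + 1 \<le> r * (s + 1)" using assms(4) by (simp add: algebra_simps)
  qed (use assms(3) n D in auto)
  ultimately have "\<Phi> \<le> 2 * moment_const * (n * D ^ (r * (s + 1)))" by linarith
  moreover have "m0 * (n * (\<delta> ^ r * D ^ (r * (s + 1)))) \<le> \<Phi>"
  proof -
    have "m0 * (n * (\<delta> ^ r * D ^ (r * (s + 1)))) \<le> m0 ^ s * M"
      using first m0(2) s_pos n \<delta> D M power_increasing[of 1 s m0] by (intro mult_mono) auto
    then show ?thesis using big by linarith
  qed
  moreover have "2 * moment_const * (n * D ^ (r * (s + 1)))
      < \<delta> ^ r * m0 * (n * D ^ (r * (s + 1)))"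
    using C(2) n D by (intro mult_strict_right_mono) (auto simp: m0_def)
  ultimately show False by (simp add: ac_simps)
qed

end

section \<open>A dense part of bounded degree\<close>

lemma exists_top_subset:
  fixes f :: "'a \<Rightarrow> nat"
  assumes "finite S" "k \<le> card S"
  shows "\<exists>T\<subseteq>S. card T = k \<and> (\<forall>x\<in>S - T. \<forall>y\<in>T. f x \<le> f y)"
  using assms(2)
proof (induction k)
  case 0
  show ?case by (intro exI[of _ "{}"]) simp
next
  case (Suc k)
  then obtain T where T: "T \<subseteq> S" "card T = k" "\<forall>x\<in>S - T. \<forall>y\<in>T. f x \<le> f y" by auto
  have fT: "finite T" using T(1) assms(1) finite_subset by blast
  have "S - T \<noteq> {}" using Suc.prems T(1,2) fT by (metis Diff_eq_empty_iff card_mono not_less_eq_eq)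
  then obtain a where a: "a \<in> S - T" and max: "\<And>x. x \<in> S - T \<Longrightarrow> f x \<le> f a"
    using obtains_MAX[of "S - T" f] assms(1) by (metis Max_ge finite_Diff finite_imageI imageI)
  have "insert a T \<subseteq> S" "card (insert a T) = Suc k" using a T fT by auto
  moreover have "\<forall>x\<in>S - insert a T. \<forall>y\<in>insert a T. f x \<le> f y" using T(3) max by auto
  ultimately show ?case by blast
qed

lemma sum_le_mult_sum_top_subset:
  fixes f :: "'a \<Rightarrow> nat"
  assumes "finite S" "T \<subseteq> S" and top: "\<And>x y. x \<in> S - T \<Longrightarrow> y \<in> T \<Longrightarrow> f x \<le> f y"
    and "0 < card T" "card S \<le> K * card T"
  shows "sum f S \<le> K * sum f T"
proof -
  have fT: "finite T" using assms(1,2) finite_subset by blast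
  have "card T * f x \<le> sum f T" if "x \<in> S - T" for x
    using sum_bounded_below[of T "f x" f] top[OF that] by simp
  then have "(\<Sum>x\<in>S - T. card T * f x) \<le> card (S - T) * sum f T"
    by (intro sum_bounded_above[THEN order_trans]) auto
  then have "card T * sum f (S - T) \<le> card (S - T) * sum f T"
    by (simp only: sum_distrib_left[of "card T" f "S - T"])
  then have "card T * sum f (S - T) + card T * sum f T \<le> (card (S - T) + card T) * sum f T"
    by (simp add: algebra_simps)
  also have "card (S - T) + card T = card S"
    using card_Diff_subset[OF fT assms(2)] card_mono[OF assms(1,2)] by simp
  also have "card S * sum f T \<le> K * card T * sum f T" using assms(5) by (rule mult_right_mono) simp
  finally have "card T * (sum f (S - T) + sum f T) \<le> card T * (K * sum f T)"
    by (simp add: algebra_simps)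
  then show ?thesis
    using assms(4) sum.subset_diff[OF assms(2,1), of f] by simp
qed

definition nbr_sum :: "('a \<Rightarrow> 'a set) \<Rightarrow> 'a set \<Rightarrow> 'a set \<Rightarrow> nat" where
  "nbr_sum N A B = (\<Sum>a\<in>A. card (N a \<inter> B))"

lemma nbr_sum_commute:
  assumes "finite A" "finite B" and sym: "\<And>u v. u \<in> N v \<Longrightarrow> v \<in> N u"
  shows "nbr_sum N A B = nbr_sum N B A"
proof -
  have "nbr_sum N A B = (\<Sum>a\<in>A. card {b \<in> B. b \<in> N a})"
    by (simp add: nbr_sum_def Int_def conj_commute)
  also have "\<dots> = (\<Sum>b\<in>B. card {a \<in> A. b \<in> N a})" by (rule sum_card_swap[OF assms(1,2)])
  also have "\<dots> = nbr_sum N B A"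
  proof -
    have "{a \<in> A. b \<in> N a} = N b \<inter> A" for b using sym by auto
    then show ?thesis by (simp add: nbr_sum_def)
  qed
  finally show ?thesis .
qed

lemma nbr_sum_mono:
  assumes "finite A'" "finite B'" "A \<subseteq> A'" "B \<subseteq> B'"
  shows "nbr_sum N A B \<le> nbr_sum N A' B'"
proof -
  have "nbr_sum N A B \<le> nbr_sum N A B'"
    unfolding nbr_sum_def using assms by (intro sum_mono card_mono) auto
  also have "\<dots> \<le> nbr_sum N A' B'"
    unfolding nbr_sum_def using assms by (intro sum_mono2) auto
  finally show ?thesis .
qed

lemma nbr_sum_Un_right:
  assumes "finite B" "finite C" "B \<inter> C = {}"
  shows "nbr_sum N A (B \<union> C) = nbr_sum N A B + nbr_sum N A C"
proof -
  have "card (N a \<inter> (B \<union> C)) = card (N a \<inter> B) + card (N a \<inter> C)" for a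
    using assms by (subst Int_Un_distrib, intro card_Un_disjoint) auto
  then show ?thesis by (simp add: nbr_sum_def sum.distrib)
qed

text \<open>Take \<open>B\<close> maximising the ratio of degree sum and \<open>card B powr \<alpha>\<close>. As \<open>\<alpha> > 1\<close>, every small
  part of \<open>B\<close> is sparse in comparison with \<open>B\<close>. In particular the vertices \<open>U\<close> of largest degree
  carry only a small share of the edges: those inside \<open>U\<close> lie in a small part, and of the others at
  least a fraction \<open>1 / K\<close> goes to the vertices with most neighbours in \<open>U\<close>, which form another small
  part. Removing \<open>U\<close> leaves half of the edges and brings the maximum degree down to the order of the
  average.\<close>

lemma exists_dense_part_of_bounded_degree:
  fixes \<alpha> c :: real and K :: nat
  assumes V: "finite V" "V \<noteq> {}" and sym: "\<And>u v. u \<in> N v \<Longrightarrow> v \<in> N u"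
    and "1 < \<alpha>" and K: "4 \<le> K" "(2 * K + 1) * (4 / K) powr \<alpha> \<le> 1 / 2"
    and c: "real K ^ 2 \<le> c" and dense: "c * real (card V) powr \<alpha> \<le> nbr_sum N V V"
  shows "\<exists>A m \<Delta>. A \<subseteq> V \<and> 1 \<le> m \<and> card A \<le> m \<and> (\<forall>v\<in>A. card (N v \<inter> A) \<le> \<Delta>) \<and>
           1 / (2 * real K) * real m * real \<Delta> \<le> nbr_sum N A A \<and>
           c * real m powr (\<alpha> - 1) \<le> \<Delta>"
proof -
  let ?e = "\<lambda>B. real (nbr_sum N B B)"
  define ratio where "ratio B = ?e B / real (card B) powr \<alpha>" for B
  have "finite (Pow V - {{}})" "Pow V - {{}} \<noteq> {}" using V by auto
  then obtain B where B0: "B \<in> Pow V - {{}}"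
    and max: "\<And>S. S \<in> Pow V - {{}} \<Longrightarrow> ratio S \<le> ratio B"
    using obtains_MAX[of "Pow V - {{}}" ratio] by (metis Max_ge finite_imageI imageI)
  then have B: "B \<subseteq> V" "B \<noteq> {}" by auto
  have fB: "finite B" using B(1) V(1) finite_subset by blast
  define m d where "m = card B" and "d = nbr_sum N B B"
  have m: "1 \<le> m" using B fB by (simp add: m_def Suc_le_eq card_gt_0_iff)
  have mp: "0 < real m powr \<alpha>" using m by simp
  have part: "?e S \<le> d * (real (card S) / m) powr \<alpha>" if "S \<subseteq> B" for S
  proof (cases "S = {}")
    case True
    then show ?thesis by (simp add: nbr_sum_def)
  next
    case False
    then have "0 < card S" using that fB finite_subset by (metis card_gt_0_iff)
    then have S: "0 < real (card S) powr \<alpha>" by simp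
    have "ratio S \<le> ratio B" using max that False B(1) by auto
    then have "?e S \<le> real d / real m powr \<alpha> * real (card S) powr \<alpha>"
      using S by (simp add: ratio_def d_def m_def pos_divide_le_eq)
    then show ?thesis by (simp add: powr_divide mult.commute)
  qed
  have d: "c * real m powr \<alpha> \<le> d"
  proof -
    have "0 < card V" using V by (simp add: card_gt_0_iff)
    then have "c \<le> ratio V" using dense by (simp add: ratio_def pos_le_divide_eq)
    also have "\<dots> \<le> ratio B" using max V by simp
    finally show ?thesis using mp by (simp add: ratio_def m_def d_def pos_le_divide_eq)
  qed
  have c1: "1 \<le> c"
  proof -
    have "1 \<le> real K ^ 2" using K(1) by (intro one_le_power) simp
    then show ?thesis using c by linarith
  qed
  have mm: "real m \<le> real m powr \<alpha>" using powr_mono[of 1 \<alpha> "real m"] assms(4) m by simp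
  have "K \<le> m"
  proof (rule ccontr)
    assume "\<not> K \<le> m"
    then have "m ^ 2 < K ^ 2" by (intro power_strict_mono) auto
    moreover have "d \<le> m * m"
      unfolding d_def nbr_sum_def
      using sum_bounded_above[of B "\<lambda>a. card (N a \<inter> B)" m] card_mono[OF fB Int_lower2]
      by (simp add: m_def)
    ultimately have "real d < real K ^ 2"
      by (metis le_less_trans of_nat_less_iff of_nat_power power2_eq_square)
    moreover have "c * 1 \<le> c * real m powr \<alpha>"
      using c1 mm m by (intro mult_left_mono) auto
    ultimately show False using d c by linarith
  qed
  define k where "k = (m + K - 1) div K"
  have K0: "0 < K" using K(1) by simp
  have kK: "m \<le> K * k"
  proof -
    have "m + K - 1 < K * k + K"
      unfolding k_def using dividend_less_times_div[OF K0, of "m + K - 1"] by linarith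
    then show ?thesis using K0 by linarith
  qed
  have Kk: "K * k \<le> 2 * m"
  proof -
    have "K * k \<le> m + K - 1" unfolding k_def by simp
    then show ?thesis using \<open>K \<le> m\<close> by linarith
  qed
  have k0: "0 < k" using kK m by (cases k) auto
  have k2: "2 * k \<le> m"
  proof -
    have "4 * k \<le> K * k" using K(1) by (rule mult_right_mono) simp
    then show ?thesis using Kk by linarith
  qed
  obtain U where U: "U \<subseteq> B" "card U = k"
    and U_top: "\<And>x y. x \<in> B - U \<Longrightarrow> y \<in> U \<Longrightarrow> card (N x \<inter> B) \<le> card (N y \<inter> B)"
    using exists_top_subset[OF fB, of k "\<lambda>x. card (N x \<inter> B)"] k2 unfolding m_def by auto
  define A where "A = B - U"
  have fU: "finite U" and fA: "finite A" using U(1) fB finite_subset by (auto simp: A_def)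
  have cA: "card A = m - k" using U fU by (simp add: A_def card_Diff_subset m_def)
  then have "k \<le> card A" using k2 by simp
  then obtain R where R: "R \<subseteq> A" "card R = k"
    and R_top: "\<And>x y. x \<in> A - R \<Longrightarrow> y \<in> R \<Longrightarrow> card (N x \<inter> U) \<le> card (N y \<inter> U)"
    using exists_top_subset[OF fA, of k "\<lambda>x. card (N x \<inter> U)"] by auto
  have RU: "R \<union> U \<subseteq> B" using R(1) U(1) by (auto simp: A_def)
  have fRU: "finite (R \<union> U)" using RU fB finite_subset by blast
  have AU: "nbr_sum N A U \<le> K * nbr_sum N (R \<union> U) (R \<union> U)"
  proof -
    have "nbr_sum N A U \<le> K * nbr_sum N R U"
      unfolding nbr_sum_def
      by (rule sum_le_mult_sum_top_subset[OF fA R(1) R_top]) (use R k0 kK cA in auto)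
    also have "\<dots> \<le> K * nbr_sum N (R \<union> U) (R \<union> U)"
      using fRU by (intro mult_left_mono nbr_sum_mono) auto
    finally show ?thesis .
  qed
  have split: "d = nbr_sum N A A + 2 * nbr_sum N A U + nbr_sum N U U"
  proof -
    have AB: "B = A \<union> U" "A \<inter> U = {}" using U(1) by (auto simp: A_def)
    have "d = nbr_sum N A B + nbr_sum N U B"
      unfolding d_def nbr_sum_def using AB fA fU by (metis sum.union_disjoint)
    also have "\<dots> = nbr_sum N A A + nbr_sum N A U + (nbr_sum N U A + nbr_sum N U U)"
      unfolding AB(1) using nbr_sum_Un_right[OF fA fU AB(2)] by simp
    finally show ?thesis using nbr_sum_commute[OF fU fA sym] by simp
  qed
  have "nbr_sum N U U \<le> nbr_sum N (R \<union> U) (R \<union> U)"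
    using fRU by (intro nbr_sum_mono) auto
  then have "2 * nbr_sum N A U + nbr_sum N U U \<le> (2 * K + 1) * nbr_sum N (R \<union> U) (R \<union> U)"
    using AU by simp
  then have "real (2 * nbr_sum N A U + nbr_sum N U U) \<le> (2 * K + 1) * ?e (R \<union> U)"
    by (metis of_nat_le_iff of_nat_mult)
  also have "\<dots> \<le> (2 * K + 1) * (d * (4 / K) powr \<alpha>)"
  proof (rule mult_left_mono)
    have "card (R \<union> U) \<le> 2 * k" using card_Un_le[of R U] R(2) U(2) by simp
    then have "K * card (R \<union> U) \<le> K * (2 * k)" by (rule mult_left_mono) simp
    then have "K * card (R \<union> U) \<le> 4 * m" using Kk by linarith
    then have "real K * real (card (R \<union> U)) \<le> 4 * real m"
      by (metis of_nat_le_iff of_nat_mult of_nat_numeral)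
    then have "real (card (R \<union> U)) / m \<le> 4 / K" using K0 m by (simp add: field_simps)
    then have "(real (card (R \<union> U)) / m) powr \<alpha> \<le> (4 / K) powr \<alpha>"
      using assms(4) by (intro powr_mono2) auto
    then have "d * (real (card (R \<union> U)) / m) powr \<alpha> \<le> d * (4 / K) powr \<alpha>"
      by (rule mult_left_mono) simp
    then show "?e (R \<union> U) \<le> d * (4 / K) powr \<alpha>" using part[OF RU] by linarith
  qed simp
  also have "\<dots> = d * ((2 * K + 1) * (4 / K) powr \<alpha>)" by simp
  also have "\<dots> \<le> d * (1 / 2)" using K(2) by (intro mult_left_mono) auto
  finally have half: "real d / 2 \<le> nbr_sum N A A" using split by simp
  define \<Delta> where "\<Delta> = (K * d) div m"
  have deg: "card (N v \<inter> A) \<le> \<Delta>" if v: "v \<in> A" for v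
  proof -
    have "card (N v \<inter> A) \<le> card (N v \<inter> B)" using fB by (intro card_mono) (auto simp: A_def)
    moreover have "k * card (N v \<inter> B) \<le> d"
    proof -
      have "card U * card (N v \<inter> B) \<le> nbr_sum N U B"
        unfolding nbr_sum_def using U_top v sum_bounded_below[of U "card (N v \<inter> B)"]
        by (auto simp: A_def)
      also have "\<dots> \<le> d" unfolding d_def using fB U(1) by (intro nbr_sum_mono) auto
      finally show ?thesis by (simp add: U(2))
    qed
    ultimately have "k * card (N v \<inter> A) \<le> d" by (meson mult_le_mono2 order_trans)
    then have "K * (k * card (N v \<inter> A)) \<le> K * d" by (rule mult_left_mono) simp
    moreover have "m * card (N v \<inter> A) \<le> K * k * card (N v \<inter> A)" using kK by (rule mult_right_mono) simp
    ultimately have "m * card (N v \<inter> A) \<le> K * d" by (metis mult.assoc order_trans)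
    then have "card (N v \<inter> A) * m \<le> K * d" by (simp only: mult.commute)
    then show ?thesis unfolding \<Delta>_def using m by (simp add: less_eq_div_iff_mult_less_eq)
  qed
  have sum: "1 / (2 * real K) * real m * real \<Delta> \<le> nbr_sum N A A"
  proof -
    have "m * \<Delta> \<le> K * d" unfolding \<Delta>_def by simp
    then have "real m * real \<Delta> \<le> real K * real d" by (metis of_nat_le_iff of_nat_mult)
    then have "1 / (2 * real K) * real m * real \<Delta> \<le> real d / 2" using K0 by (simp add: field_simps)
    then show ?thesis using half by linarith
  qed
  have large: "c * real m powr (\<alpha> - 1) \<le> \<Delta>"
  proof -
    have md: "real m \<le> d"
    proof -
      have "1 * real m \<le> c * real m powr \<alpha>" using c1 mm by (intro mult_mono) auto
      then show ?thesis using d by linarith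
    qed
    have "K * d < (\<Delta> + 1) * m" unfolding \<Delta>_def using m dividend_less_div_times[of m "K * d"] by simp
    then have "real K * real d < (real \<Delta> + 1) * real m"
      by (metis of_nat_less_iff of_nat_mult of_nat_add of_nat_1)
    moreover have "4 * real d \<le> real K * real d" using K(1) by (intro mult_right_mono) auto
    ultimately have "real d \<le> real \<Delta> * real m" using md by (simp add: algebra_simps)
    then have "c * real m powr \<alpha> \<le> real \<Delta> * real m" using d by linarith
    moreover have "real m powr \<alpha> = real m powr (\<alpha> - 1) * real m"
      using m powr_add[of "real m" "\<alpha> - 1" 1] by simp
    ultimately have "(c * real m powr (\<alpha> - 1)) * real m \<le> real \<Delta> * real m" by (simp add: ac_simps)
    then show ?thesis using m by simp
  qed
  have "A \<subseteq> V" using B(1) by (auto simp: A_def)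
  moreover have "card A \<le> m" using cA by simp
  ultimately show ?thesis using m deg sum large by blast
qed

text \<open>As \<open>\<alpha> > 1\<close>, the left-hand side decays like \<open>K powr (1 - \<alpha>)\<close>.\<close>

lemma exists_partition_number:
  fixes \<alpha> :: real
  assumes "1 < \<alpha>"
  shows "\<exists>K. (4 :: nat) \<le> K \<and> real (2 * K + 1) * (4 / real K) powr \<alpha> \<le> 1 / 2"
proof -
  define x :: real where "x = (6 * 4 powr \<alpha>) powr (1 / (\<alpha> - 1))"
  define K where "K = nat \<lceil>x\<rceil> + 4"
  have K4: "4 \<le> K" by (simp add: K_def)
  have "x \<le> real K" unfolding K_def by linarith
  moreover have "0 \<le> x" by (simp add: x_def)
  ultimately have "x powr (\<alpha> - 1) \<le> real K powr (\<alpha> - 1)" using assms by (intro powr_mono2) auto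
  then have K: "6 * 4 powr \<alpha> \<le> real K powr (\<alpha> - 1)" using assms by (simp add: x_def powr_powr)
  have Kp: "0 < real K powr \<alpha>" using K4 by simp
  have "real K powr \<alpha> = real K powr (\<alpha> - 1) * real K"
    using K4 powr_add[of "real K" "\<alpha> - 1" 1] by simp
  then have "6 * 4 powr \<alpha> * real K \<le> real K powr \<alpha>" using K by (simp add: mult_right_mono)
  then have "3 * real K * 4 powr \<alpha> \<le> 1 / 2 * real K powr \<alpha>" by (simp add: ac_simps)
  then have "3 * real K * (4 / K) powr \<alpha> \<le> 1 / 2"
    using Kp by (simp add: powr_divide pos_divide_le_eq)
  moreover have "(2 * K + 1) * (4 / K) powr \<alpha> \<le> 3 * real K * (4 / K) powr \<alpha>"
    using K4 by (intro mult_right_mono) auto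
  ultimately have "(2 * K + 1) * (4 / K) powr \<alpha> \<le> 1 / 2" by linarith
  with K4 show ?thesis by blast
qed

section \<open>The extremal number\<close>

lemma contains_blowup_of_disjoint_copies:
  assumes G: "simple_graph G"
    and Y: "Y \<subseteq> verts G" "t \<le> card Y"
    and W: "\<And>i. i < r \<Longrightarrow> W i \<subseteq> verts G \<and> card (W i) = s"
    and copies: "disjoint_copies N r W Y z"
    and N: "\<And>u v. u \<in> N v \<Longrightarrow> {u, v} \<in> edges G"
  shows "contains_subgraph G (blowup (F_graph r s) t)"
proof -
  have fin: "finite (verts G)" using G by (simp add: simple_graph_def)
  obtain Y' where Y': "Y' \<subseteq> Y" "card Y' = t" using obtain_subset_with_card_n[OF Y(2)] by metis
  have "finite Y'" using Y' Y(1) fin by (meson finite_subset)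
  then obtain y where "bij_betw y {1..t} Y'" using ex_bij_betw_nat_finite_1 Y'(2) by blast
  then have y_inj: "inj_on y {1..t}" and yY: "\<And>k. k \<in> {1..t} \<Longrightarrow> y k \<in> Y"
    using Y'(1) by (auto simp: bij_betw_def)
  have "\<exists>h. bij_betw h {1..s} (W i)" if "i < r" for i
    using ex_bij_betw_nat_finite_1[of "W i"] W[OF that] finite_subset[OF _ fin] by auto
  then obtain w where w: "\<And>i. i < r \<Longrightarrow> bij_betw (w i) {1..s} (W i)" by metis
  have w_inj: "j = j'" if "i < r" "j \<in> {1..s}" "j' \<in> {1..s}" "w i j = w i j'" for i j j'
    using inj_onD[OF bij_betw_imp_inj_on[OF w[OF that(1)]] that(4,2,3)] .
  have wW: "w i j \<in> W i" if "i < r" "j \<in> {1..s}" for i j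
    using bij_betw_apply[OF w[OF that(1)] that(2)] .
  have WW: "W i \<inter> W j = {}" if "i < r" "j < r" "i \<noteq> j" for i j
    using copies that by (simp add: disjoint_copies_def)
  have YW: "v \<notin> W i" if "v \<in> Y" "i < r" for v i
    using copies that by (auto simp: disjoint_copies_def)
  have zN: "insert v (W i) \<subseteq> N (z v i)" if "v \<in> Y" "i < r" for v i
    using copies that by (auto simp: disjoint_copies_def)
  have zY: "z v i \<notin> Y" if "v \<in> Y" "i < r" for v i
    using copies that by (auto simp: disjoint_copies_def)
  have zW: "z v i \<notin> W j" if "v \<in> Y" "i < r" "j < r" for v i j
    using copies that by (auto simp: disjoint_copies_def)
  have z_inj: "v = v' \<and> i = i'" if "v \<in> Y" "v' \<in> Y" "i < r" "i' < r" "z v i = z v' i'" for v v' i i'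
  proof -
    have "inj_on (\<lambda>(y, i). z y i) (Y \<times> {..<r})" using copies by (simp add: disjoint_copies_def)
    then show ?thesis using that by (auto dest!: inj_onD[where x = "(v, i)" and y = "(v', i')"])
  qed
  \<comment> \<open>The branches of the tree are numbered from 1, the root sets from 0. The values on labels that
    are not vertices of the blowup are arbitrary.\<close>
  define f where "f v = (case v of
      Inl x \<Rightarrow> (case x of Fw i j \<Rightarrow> w (i - 1) j | _ \<Rightarrow> y 1)
    | Inr (k, x) \<Rightarrow> (case x of Fz i \<Rightarrow> z (y k) (i - 1) | _ \<Rightarrow> y k))" for v
  have f [simp]: "f (Inl (Fw i j)) = w (i - 1) j" "f (Inr (k, Fy)) = y k"
    "f (Inr (k, Fz i)) = z (y k) (i - 1)" for i j k
    by (simp_all add: f_def)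
  have copy [simp]: "copy_vertex (roots (F_graph r s)) k Fy = Inr (k, Fy)"
    "copy_vertex (roots (F_graph r s)) k (Fz i) = Inr (k, Fz i)" for k i
    by (auto simp: copy_vertex_def F_graph_def)
  have copy_w [simp]: "copy_vertex (roots (F_graph r s)) k (Fw i j) = Inl (Fw i j)"
    if "i \<in> {1..r}" "j \<in> {1..s}" for i j k
    using that by (auto simp: copy_vertex_def F_graph_def)
  have verts_cases: "(\<exists>k\<in>{1..t}. x = Inr (k, Fy)) \<or> (\<exists>k\<in>{1..t}. \<exists>i\<in>{1..r}. x = Inr (k, Fz i)) \<or>
      (\<exists>i\<in>{1..r}. \<exists>j\<in>{1..s}. x = Inl (Fw i j))" if x: "x \<in> verts (blowup (F_graph r s) t)" for x
  proof -
    obtain k v where kv: "k \<in> {1..t}" "v \<in> verts (F_graph r s)"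
      "x = copy_vertex (roots (F_graph r s)) k v"
      using x by (auto simp: blowup_def)
    from kv(2) consider "v = Fy" | i where "i \<in> {1..r}" "v = Fz i"
      | i j where "i \<in> {1..r}" "j \<in> {1..s}" "v = Fw i j"
      by (auto simp: F_graph_def)
    then show ?thesis using kv(1,3) by cases auto
  qed
  have edge_z: "{v, z v i} \<in> edges G" if "v \<in> Y" "i < r" for v i
    using zN[OF that] N by auto
  have z_verts: "z v i \<in> verts G" if "v \<in> Y" "i < r" for v i
    using edge_z[OF that] G by (auto simp: simple_graph_def)
  have less: "i - 1 < r" if "i \<in> {1..r}" for i using that by auto
  have "inj_on f (verts (blowup (F_graph r s) t))"
  proof (rule inj_onI)
    fix a b assume ab: "a \<in> verts (blowup (F_graph r s) t)" "b \<in> verts (blowup (F_graph r s) t)"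
      and eq: "f a = f b"
    from verts_cases[OF ab(1)] show "a = b"
    proof (elim disjE bexE)
      fix k assume a: "k \<in> {1..t}" "a = Inr (k, Fy)"
      from verts_cases[OF ab(2)] show ?thesis
      proof (elim disjE bexE)
        fix k' assume "k' \<in> {1..t}" "b = Inr (k', Fy)"
        then show ?thesis using a eq inj_onD[OF y_inj, of k k'] by simp
      next
        fix k' i assume "k' \<in> {1..t}" "i \<in> {1..r}" "b = Inr (k', Fz i)"
        then show ?thesis using a eq zY[of "y k'" "i - 1"] yY less by (metis f(2,3))
      next
        fix i j assume "i \<in> {1..r}" "j \<in> {1..s}" "b = Inl (Fw i j)"
        then show ?thesis using a eq YW[of "y k" "i - 1"] yY wW less by (metis f(1,2))
      qed
    next
      fix k i assume a: "k \<in> {1..t}" "i \<in> {1..r}" "a = Inr (k, Fz i)"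
      from verts_cases[OF ab(2)] show ?thesis
      proof (elim disjE bexE)
        fix k' assume "k' \<in> {1..t}" "b = Inr (k', Fy)"
        then show ?thesis using a eq zY[of "y k" "i - 1"] yY less by (metis f(2,3))
      next
        fix k' i' assume b: "k' \<in> {1..t}" "i' \<in> {1..r}" "b = Inr (k', Fz i')"
        then have "y k = y k' \<and> i - 1 = i' - 1"
          using a eq z_inj[of "y k" "y k'" "i - 1" "i' - 1"] yY less by simp
        then have "k = k'" "i = i'" using a b inj_onD[OF y_inj, of k k'] by auto
        then show ?thesis using a b by simp
      next
        fix i' j assume "i' \<in> {1..r}" "j \<in> {1..s}" "b = Inl (Fw i' j)"
        then show ?thesis using a eq zW[of "y k" "i - 1" "i' - 1"] yY wW less by (metis f(1,3))
      qed
    next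
      fix i j assume a: "i \<in> {1..r}" "j \<in> {1..s}" "a = Inl (Fw i j)"
      from verts_cases[OF ab(2)] show ?thesis
      proof (elim disjE bexE)
        fix k' assume "k' \<in> {1..t}" "b = Inr (k', Fy)"
        then show ?thesis using a eq YW[of "y k'" "i - 1"] yY wW less by (metis f(1,2))
      next
        fix k' i' assume "k' \<in> {1..t}" "i' \<in> {1..r}" "b = Inr (k', Fz i')"
        then show ?thesis using a eq zW[of "y k'" "i' - 1" "i - 1"] yY wW less by (metis f(1,3))
      next
        fix i' j' assume b: "i' \<in> {1..r}" "j' \<in> {1..s}" "b = Inl (Fw i' j')"
        then have e: "w (i - 1) j = w (i' - 1) j'" using a eq by simp
        then have "i - 1 = i' - 1"
          using WW[of "i - 1" "i' - 1"] wW[OF less[OF a(1)] a(2)] wW[OF less[OF b(1)] b(2)]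
            less[OF a(1)] less[OF b(1)] by auto
        then have "i = i'" using a b by auto
        then show ?thesis using w_inj[OF less[OF a(1)] a(2) b(2)] e a b by simp
      qed
    qed
  qed
  moreover have "f ` verts (blowup (F_graph r s) t) \<subseteq> verts G"
  proof
    fix x assume "x \<in> f ` verts (blowup (F_graph r s) t)"
    then obtain a where a: "a \<in> verts (blowup (F_graph r s) t)" "x = f a" by auto
    from verts_cases[OF a(1)] show "x \<in> verts G"
    proof (elim disjE bexE)
      fix k assume "k \<in> {1..t}" "a = Inr (k, Fy)"
      then show ?thesis using a(2) yY Y(1) by auto
    next
      fix k i assume "k \<in> {1..t}" "i \<in> {1..r}" "a = Inr (k, Fz i)"
      then show ?thesis using a(2) z_verts yY less by simp
    next
      fix i j assume ij: "i \<in> {1..r}" "j \<in> {1..s}" "a = Inl (Fw i j)"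
      then have "x \<in> W (i - 1)" using a(2) wW[OF less[OF ij(1)] ij(2)] by simp
      then show ?thesis using W[OF less[OF ij(1)]] by blast
    qed
  qed
  moreover have "\<forall>e\<in>edges (blowup (F_graph r s) t). f ` e \<in> edges G"
  proof
    fix e assume "e \<in> edges (blowup (F_graph r s) t)"
    then obtain k e' where e: "k \<in> {1..t}" "e' \<in> edges (F_graph r s)"
      "e = copy_vertex (roots (F_graph r s)) k ` e'"
      by (auto simp: blowup_def)
    from e(2) consider i where "i \<in> {1..r}" "e' = {Fy, Fz i}"
      | i j where "i \<in> {1..r}" "j \<in> {1..s}" "e' = {Fz i, Fw i j}"
      by (auto simp: F_graph_def)
    then show "f ` e \<in> edges G"
    proof cases
      case 1
      then show ?thesis using e edge_z[OF yY less] by simp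
    next
      case 2
      then have "w (i - 1) j \<in> N (z (y k) (i - 1))" using zN[OF yY less] wW less e(1) by blast
      then show ?thesis using N 2 e by (simp add: insert_commute)
    qed
  qed
  ultimately show ?thesis unfolding contains_subgraph_def by blast
qed

lemma card_edges_le_nbr_sum:
  assumes "simple_graph G"
  defines "N \<equiv> \<lambda>v. {u. {u, v} \<in> edges G}"
  shows "card (edges G) \<le> nbr_sum N (verts G) (verts G)"
proof -
  let ?P = "SIGMA v:verts G. N v \<inter> verts G"
  have fin: "finite (verts G)" using assms(1) by (simp add: simple_graph_def)
  have "edges G \<subseteq> (\<lambda>(v, u). {u, v}) ` ?P"
  proof
    fix e assume e: "e \<in> edges G"
    then have "e \<subseteq> verts G" "card e = 2" using assms(1) by (auto simp: simple_graph_def)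
    then obtain u v where uv: "e = {u, v}" "u \<in> verts G" "v \<in> verts G"
      by (auto simp: card_2_iff)
    then have "(v, u) \<in> ?P" using e by (simp add: N_def)
    then show "e \<in> (\<lambda>(v, u). {u, v}) ` ?P" using uv(1) by force
  qed
  then have "card (edges G) \<le> card ?P" using fin by (intro surj_card_le) auto
  then show ?thesis using fin by (simp add: nbr_sum_def)
qed

lemma blowup_free_induced:
  fixes A :: "'a set"
  assumes G: "simple_graph G" and free: "\<not> contains_subgraph G (blowup (F_graph r s) t)"
    and A: "A \<subseteq> verts G" and pos: "1 \<le> r" "1 \<le> s" "1 \<le> t"
  defines "N \<equiv> \<lambda>v. {u. {u, v} \<in> edges G}"
  assumes deg: "\<And>v. v \<in> A \<Longrightarrow> card (N v \<inter> A) \<le> \<Delta>"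
  shows "blowup_free A (\<lambda>v. if v \<in> A then N v \<inter> A else {}) r s t \<Delta>"
proof (unfold_locales, goal_cases)
  case 1
  show ?case using G A finite_subset by (auto simp: simple_graph_def)
next
  case (3 u v)
  then show ?case by (auto simp: N_def insert_commute split: if_splits)
next
  case (4 v)
  have "{v} \<notin> edges G" using G by (auto simp: simple_graph_def)
  then show ?case by (simp add: N_def)
next
  case (9 Y W z)
  have W: "W i \<subseteq> verts G \<and> card (W i) = s" if "i < r" for i using 9(2)[OF that] A by blast
  show ?case
  proof (rule ccontr)
    assume "\<not> card Y < t"
    then have "contains_subgraph G (blowup (F_graph r s) t)"
      using 9(1) A by (intro contains_blowup_of_disjoint_copies[OF G _ _ W 9(3)])
        (auto simp: N_def split: if_splits)
    then show False using free by simp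
  qed
qed (use deg pos in auto)

lemma edges_le_of_blowup_free:
  assumes "s + 2 \<le> r" "1 \<le> s" "1 \<le> t"
  shows "\<exists>c::real. \<forall>G :: nat graph. simple_graph G \<longrightarrow> verts G \<noteq> {} \<longrightarrow>
    \<not> contains_subgraph G (blowup (F_graph r s) t) \<longrightarrow>
    card (edges G) \<le> c * card (verts G) powr (2 - (real r + 1) / (real r * real s + real r))"
proof -
  define \<alpha> where "\<alpha> = 2 - (real r + 1) / (real r * real s + real r)"
  define q where "q = r * (s + 1)"
  have r: "0 < r" "1 \<le> r" and q: "0 < q" using assms by (auto simp: q_def)
  have "r \<le> r * s" using assms(2) by simp
  then have rs2: "2 \<le> r * s" using assms(1) by linarith
  have "(real r + 1) / (real r * real s + real r) < 1"
  proof -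
    have "real 2 \<le> real (r * s)" using rs2 by (simp only: of_nat_le_iff)
    then show ?thesis using r by (simp add: divide_less_eq)
  qed
  then have \<alpha>: "1 < \<alpha>" by (simp add: \<alpha>_def)
  have exponent: "(\<alpha> - 1) * real q = real (r * s) - 1"
  proof -
    have "real r * real s + real r = real q" by (simp add: q_def algebra_simps)
    then have "\<alpha> = 2 - (real r + 1) / real q" by (simp add: \<alpha>_def)
    then have "(\<alpha> - 1) * real q = real q - (real r + 1)"
      using q by (simp add: left_diff_distrib)
    then show ?thesis by (simp add: q_def algebra_simps)
  qed
  obtain K :: nat where K: "4 \<le> K" "(2 * K + 1) * (4 / K) powr \<alpha> \<le> 1 / 2"
    using exists_partition_number[OF \<alpha>] by blast
  define heavy light_factor many T where "heavy = blowup_free.heavy r s t"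
    and "light_factor = blowup_free.light_factor r s t" and "many = blowup_free.many r s t"
    and "T = blowup_free.moment_const r s t"
  define \<gamma> \<delta> where "\<gamma> = 1 / (2 * real K)" and "\<delta> = \<gamma> ^ (s + 1) / (2 * light_factor * heavy)"
  define L where "L = real ((t + r * s) ^ (s + 1) + r * (s + heavy))"
  \<comment> \<open>Apart from 1, there is one summand for each lower bound that \<open>c\<close> has to satisfy: for the
    passage to a dense part, for the maximum degree, and for the two conditions on the constant
    \<open>c ^ q\<close> in the density of that part.\<close>
  define c where
    "c = 1 + real K ^ 2 + L / \<delta> + 4 * many / \<delta> ^ r + (2 * T + 1) / (\<delta> ^ r * \<delta> ^ r)"
  show ?thesis
  proof (intro exI[of _ c] allI impI, fold \<alpha>_def, rule ccontr)
    fix G :: "nat graph"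
    assume G: "simple_graph G" "verts G \<noteq> {}"
      and free: "\<not> contains_subgraph G (blowup (F_graph r s) t)"
      and many_edges: "\<not> card (edges G) \<le> c * card (verts G) powr \<alpha>"
    have fin: "finite (verts G)" using G by (simp add: simple_graph_def)
    define N where "N v = {u. {u, v} \<in> edges G}" for v
    \<comment> \<open>The constants do not depend on the graph, so the empty graph shows that they are positive.\<close>
    have "blowup_free {} (\<lambda>v. if v \<in> {} then N v \<inter> {} else {}) r s t 0"
      unfolding N_def using assms r by (intro blowup_free_induced[OF G(1) free]) auto
    then have "1 \<le> light_factor * heavy" unfolding light_factor_def heavy_def
      by (rule blowup_free.light_factor_heavy_pos)
    then have \<delta>: "0 < \<delta>" using K(1) by (auto simp: \<delta>_def \<gamma>_def)
    have nonneg: "0 \<le> L / \<delta>" "0 \<le> 4 * many / \<delta> ^ r" "0 \<le> (2 * T + 1) / (\<delta> ^ r * \<delta> ^ r)"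
      "0 \<le> real K ^ 2"
      using \<delta> by (auto simp: L_def)
    then have c: "1 \<le> c" "real K ^ 2 \<le> c" "L / \<delta> \<le> c" "4 * many / \<delta> ^ r \<le> c"
      "(2 * T + 1) / (\<delta> ^ r * \<delta> ^ r) \<le> c"
      unfolding c_def by linarith+
    have "real (card (edges G)) \<le> nbr_sum N (verts G) (verts G)"
      using card_edges_le_nbr_sum[OF G(1)] by (simp add: N_def[abs_def])
    then have dense: "c * real (card (verts G)) powr \<alpha> \<le> nbr_sum N (verts G) (verts G)"
      using many_edges by linarith
    have sym: "v \<in> N u" if "u \<in> N v" for u v using that by (simp add: N_def insert_commute)
    obtain A m \<Delta> where A: "A \<subseteq> verts G" "1 \<le> m" "card A \<le> m"
      and deg: "\<forall>v\<in>A. card (N v \<inter> A) \<le> \<Delta>"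
      and sum: "\<gamma> * real m * real \<Delta> \<le> nbr_sum N A A"
      and large: "c * real m powr (\<alpha> - 1) \<le> \<Delta>"
      using exists_dense_part_of_bounded_degree[of "verts G" N \<alpha> K c, OF fin G(2) sym \<alpha> K c(2) dense]
      unfolding \<gamma>_def by blast
    interpret H: blowup_free A "\<lambda>v. if v \<in> A then N v \<inter> A else {}" r s t \<Delta>
      unfolding N_def using assms r A deg
      by (intro blowup_free_induced[OF G(1) free]) (auto simp: N_def)
    have "1 \<le> real m powr (\<alpha> - 1)" using A(2) \<alpha> by (intro ge_one_powr_ge_zero) auto
    then have "c * 1 \<le> c * real m powr (\<alpha> - 1)" using c(1) by (intro mult_left_mono) auto
    then have "c \<le> \<Delta>" using large by linarith
    then have "L / \<delta> \<le> \<Delta>" using c(3) by linarith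
    then have "L \<le> \<delta> * \<Delta>" using \<delta> by (simp add: divide_le_eq mult.commute)
    have cq: "c \<le> c ^ q" using power_increasing[of 1 q c] q c(1) by simp
    have C1: "4 * many \<le> \<delta> ^ r * c ^ q"
    proof -
      have "4 * many / \<delta> ^ r \<le> c ^ q" using c(4) cq by linarith
      then show ?thesis using \<delta> by (simp add: divide_le_eq mult.commute)
    qed
    have C2: "2 * T < \<delta> ^ r * (\<delta> ^ r * c ^ q)"
    proof -
      have "(2 * T + 1) / (\<delta> ^ r * \<delta> ^ r) \<le> c ^ q" using c(5) cq by linarith
      then have "2 * T + 1 \<le> \<delta> ^ r * \<delta> ^ r * c ^ q" using \<delta> by (simp add: divide_le_eq mult.commute)
      then show ?thesis by (simp add: mult.assoc)
    qed
    have "c ^ q * real m ^ (r * s) \<le> real m * real \<Delta> ^ q"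
    proof -
      have "(c * real m powr (\<alpha> - 1)) ^ q \<le> real \<Delta> ^ q"
        using large c(1) by (intro power_mono) auto
      moreover have "(real m powr (\<alpha> - 1)) ^ q = real m powr (real (r * s) - 1)"
        using A(2) by (simp add: powr_powr exponent flip: powr_realpow)
      ultimately have "real m * (c ^ q * real m powr (real (r * s) - 1)) \<le> real m * real \<Delta> ^ q"
        by (intro mult_left_mono) (simp_all add: power_mult_distrib)
      moreover have "real m * real m powr (real (r * s) - 1) = real m ^ (r * s)"
        using A(2) powr_add[of "real m" 1 "real (r * s) - 1"] powr_realpow[of "real m" "r * s"]
        by simp
      ultimately show ?thesis by (metis mult.left_commute)
    qed
    then have "(\<Sum>v\<in>A. card (if v \<in> A then N v \<inter> A else {})) < \<gamma> * real m * \<Delta>"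
      using H.degree_sum_lt[of \<gamma> "real m" "c ^ q"] K(1) A assms \<open>L \<le> \<delta> * \<Delta>\<close> C1 C2
      by (simp add: \<gamma>_def \<delta>_def L_def heavy_def light_factor_def many_def T_def q_def)
    then show False using sum by (simp add: nbr_sum_def)
  qed
qed

theorem theorem1p5:
  fixes r s t :: nat
  assumes "r \<ge> s + 2" and "s + 2 \<ge> 3" and "t \<ge> 1"
  shows "(\<lambda>n::nat. real (ex_num n (blowup (F_graph r s) t)))
           \<in> O(\<lambda>n. real n powr (2 - (real r + 1) / (real r * real s + real r)))"
proof -
  let ?H = "blowup (F_graph r s) t" and ?\<alpha> = "2 - (real r + 1) / (real r * real s + real r)"
  have s: "1 \<le> s" using assms(2) by simp
  obtain c :: real where c: "\<And>G :: nat graph. simple_graph G \<Longrightarrow> verts G \<noteq> {} \<Longrightarrow>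
      \<not> contains_subgraph G ?H \<Longrightarrow> card (edges G) \<le> c * card (verts G) powr ?\<alpha>"
    using edges_le_of_blowup_free[OF assms(1) s assms(3)] by blast
  have "real (ex_num n ?H) \<le> c * real n powr ?\<alpha>" if n: "1 \<le> n" for n
  proof -
    define E where "E = {card (edges G) | G :: nat graph.
      simple_graph G \<and> card (verts G) = n \<and> \<not> contains_subgraph G ?H}"
    have E: "real e \<le> c * real n powr ?\<alpha>" if "e \<in> E" for e
    proof -
      obtain G :: "nat graph" where G: "e = card (edges G)" "simple_graph G" "card (verts G) = n"
        "\<not> contains_subgraph G ?H"
        using \<open>e \<in> E\<close> unfolding E_def by blast
      then have "verts G \<noteq> {}" using n by auto
      then show ?thesis using c[OF G(2) _ G(4)] G(1,3) by simp
    qed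
    have "finite E"
    proof (rule finite_subset)
      show "E \<subseteq> {..nat \<lfloor>c * real n powr ?\<alpha>\<rfloor>}" using E by (auto intro: le_nat_floor)
    qed simp
    \<comment> \<open>The edgeless graph on \<open>n\<close> vertices shows that the maximum is over a nonempty set.\<close>
    moreover have "E \<noteq> {}"
    proof -
      let ?G = "\<lparr>verts = {..<n}, edges = {}\<rparr> :: nat graph"
      have "{Fy, Fz 1} \<in> edges (F_graph r s)" using assms by (auto simp: F_graph_def)
      then have "edges ?H \<noteq> {}" using assms(3) by (auto simp: blowup_def)
      then have "\<not> contains_subgraph ?G ?H" by (auto simp: contains_subgraph_def)
      then have "card (edges ?G) \<in> E" unfolding E_def mem_Collect_eq
        by (intro exI[of _ ?G]) (simp add: simple_graph_def)
      then show ?thesis by blast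
    qed
    ultimately have "ex_num n ?H \<in> E" unfolding ex_num_def E_def[symmetric] by (rule Max_in)
    then show ?thesis by (rule E)
  qed
  then have "\<forall>\<^sub>F n in sequentially. norm (real (ex_num n ?H)) \<le> c * norm (real n powr ?\<alpha>)"
    by (intro eventually_sequentiallyI[of 1]) simp
  then show ?thesis by (rule bigoI)
qed

end
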